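(* Let $W_i(z)=\Lambda_i^+(z)+\Lambda_i^-(z)$ ($i=1,2$) and $S^\pm(w)=S_1^\pm(w)-S_2^\pm(w)$ be the currents defined in the context. Then, with $[A,B]_+=AB+BA$, $$[W_1(z),S^\pm(w)]_+=w^{-1}(T_{s_\pm,w}-1)\,\delta\Big(\frac{w}{s_\pm^{1/2}z}\Big):\Lambda_1^+(s_\pm^{-1/2}w)S_2^\pm(w):,$$ $$[W_2(z),S^\pm(w)]_+=w^{-1}(1-T_{s_\pm,w})\,\delta\Big(\frac{w}{s_\pm^{1/2}z}\Big):\Lambda_2^+(s_\pm^{-1/2}w)S_1^\pm(w):.$$ Here $T_{p,w}$ is the difference operator $T_{p,w}f(w)=f(pw)$ (acting on the whole product of the delta function and the normally ordered operator to its right).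
   Context: Parameters: $q,d\in\mathbb C$ with $q^nd^m\ne1$ for all integers $(n,m)\neq(0,0)$; $q_1=q^{-1}d$, $q_2=q^2$, $q_3=q^{-1}d^{-1}$ (so $q_1q_2q_3=1$); $\beta=-\log q_3/\log q_1$, so $q_3=q_1^{-\beta}$. Fractional powers are taken with respect to $q_1=e^\hbar$, $q_3=e^{-\beta\hbar}$, $q=e^{(\beta-1)\hbar/2}$. Formal delta function: $\delta(z)=\sum_{n\in\mathbb Z}z^n$. Heisenberg algebra: generators $h^\perp_{i,n},Q_i^\perp$ ($i=1,2$, $n\in\mathbb Z$), $\mathsf a_0^\perp,\mathsf Q^\perp$ with $[h^\perp_{i,n},h^\perp_{i,m}]=n\delta_{n+m,0}$; $[h^\perp_{i,n},h^\perp_{j,m}]=-n\frac{q_1^n+q_3^n}{1+q_2^{-n}}\delta_{n+m,0}$ for $i\ne j$; $[h^\perp_{i,0},Q_i^\perp]=1$, $[h^\perp_{i,0},Q^\perp_j]=-1$ for $i\ne j$; $[\mathsf a_0^\perp,\mathsf Q^\perp]=\beta/2$; $h^\perp_{1,0}=-h^\perp_{2,0}$, $Q_1^\perp=-Q_2^\perp$; other commutators vanish. $:\ast:$ is the normal ordering (modes with $n<0$ and $Q_i^\perp,\mathsf Q^\perp$ to the left; modes with $n\ge 0$ and $\mathsf a_0^\perp$ to the right). $$\Lambda_i^+(z)=:\exp\Big(-\sum_{n\ne0}\frac{q^n}{n}h^\perp_{i,n}z^{-n}\Big):e^{Q_i^\perp}(q^{-1}z)^{h^\perp_{i,0}}q_1^{\mathsf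 a_0^\perp},\qquad \Lambda_i^-(z)=:\exp\Big(\sum_{n\ne0}\frac{q^{-n}}{n}h^\perp_{i,n}z^{-n}\Big):e^{-Q_i^\perp}(qz)^{-h^\perp_{i,0}}q_1^{-\mathsf a_0^\perp}.$$ Screening currents: $\tau_+=1/\beta$, $\tau_-=-1$, $s_+=q_3$, $s_-=q_1$. With $\gamma^\pm_n=\dfrac{s_\pm^{n/2}(1+q_2^n)}{n\,q^n(1-s_\pm^{2n})}$, $$S_1^\pm(z)=\exp\Big(\sum_{n>0}\gamma_n^\pm(h^\perp_{1,-n}+s_\pm^nh^\perp_{2,-n})z^n\Big)\exp\Big(\sum_{n>0}\gamma_n^\pm(s_\pm^nh^\perp_{1,n}+h^\perp_{2,n})z^{-n}\Big)e^{Q_1^\perp+\tau_\pm\mathsf Q^\perp}z^{h^\perp_{1,0}+2\tau_\pm\mathsf a_0^\perp},$$ $$S_2^\pm(z)=\exp\Big(\sum_{n>0}\gamma_n^\pm(s_\pm^nh^\perp_{1,-n}+h^\perp_{2,-n})z^n\Big)\exp\Big(\sum_{n>0}\gamma_n^\pm(h^\perp_{1,n}+s_\pm^nh^\perp_{2,n})z^{-n}\Big)e^{-Q_1^\perp+\tau_\pm\mathsf Q^\perp}z^{-h^\perp_{1,0}+2\tau_\pm\mathsf a_0^\perp}.$$ All products are formal series in $z,w$, with contraction factors of $A(z)B(w)$ expanded in nonnegative powers of $w/z$ (and of $B(w)A(z)$ in nonnegative powers of $z/w$). *)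

theory Defs
  imports Complex_Main "HOL-Library.Groups_Big_Fun"
begin

section \<open>Parameters\<close>

text \<open>
  Fractional powers need logarithms of \<open>q\<^sub>1\<close>, \<open>q\<^sub>3\<close> and \<open>q\<close>. The branches are those
  determined by \<open>hbar\<close> and \<open>beta\<close>: \<open>log q\<^sub>1 = hbar\<close>, \<open>log q\<^sub>3 = - beta * hbar\<close>,
  \<open>log q = (beta - 1) * hbar / 2\<close>. Every choice satisfying \<open>valid_params\<close> is admitted, not just the
  principal one.
\<close>

record params =
  qq :: complex
  dd :: complex
  hbar :: complex
  beta :: complex

definition q1 :: "params \<Rightarrow> complex" where "q1 p = inverse (qq p) * dd p"
definition q2 :: "params \<Rightarrow> complex" where "q2 p = (qq p)\<^sup>2"
definition q3 :: "params \<Rightarrow> complex" where "q3 p = inverse (qq p) * inverse (dd p)"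

definition log_q :: "params \<Rightarrow> complex" where "log_q p = (beta p - 1) * hbar p / 2"

definition valid_params :: "params \<Rightarrow> bool" where
  "valid_params p \<longleftrightarrow>
     qq p \<noteq> 0 \<and> dd p \<noteq> 0 \<and>
     (\<forall>n m :: int. (n, m) \<noteq> (0, 0) \<longrightarrow> qq p powi n * dd p powi m \<noteq> 1) \<and>
     q1 p = exp (hbar p) \<and> q3 p = exp (- beta p * hbar p) \<and> qq p = exp (log_q p)"

text \<open>The sign in \<open>S\<^sup>\<plusminus>\<close>, \<open>s\<^sub>\<plusminus>\<close>, \<open>\<tau>\<^sub>\<plusminus>\<close>.\<close>
datatype pm = Plus | Minus

fun tau :: "params \<Rightarrow> pm \<Rightarrow> complex" where
  "tau p Plus = 1 / beta p"
| "tau p Minus = - 1"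

fun s :: "params \<Rightarrow> pm \<Rightarrow> complex" where
  "s p Plus = q3 p"
| "s p Minus = q1 p"

fun log_s :: "params \<Rightarrow> pm \<Rightarrow> complex" where
  "log_s p Plus = - beta p * hbar p"
| "log_s p Minus = hbar p"

definition gam :: "params \<Rightarrow> pm \<Rightarrow> int \<Rightarrow> complex" where
  "gam p \<sigma> n = exp (of_int n / 2 * log_s p \<sigma>) * (1 + q2 p powi n)
     / (of_int n * qq p powi n * (1 - s p \<sigma> powi (2 * n)))"


section \<open>Modules over the Heisenberg algebra\<close>

text \<open>
  Identities between currents are identities of operators on every module of the following kind.
  The operators \<open>Q\<^sub>i\<close>, \<open>Q\<close> occur in the currents only through exponentials, and on a module
  where \<open>h\<^sub>i\<^sub>,\<^sub>0\<close> and \<open>a\<^sub>0\<close> are diagonalisable only these exponentials act.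
  So \<open>expQ\<close> is the data: \<open>expQ M k t\<close> stands for \<open>exp (k Q\<^sub>1 + t Q)\<close>, and
  \<open>Q\<^sub>2 = - Q\<^sub>1\<close> is used to express \<open>exp (k Q\<^sub>2)\<close> as \<open>expQ M (- k) 0\<close>.
\<close>

record 'v heis_module =
  scl :: "complex \<Rightarrow> 'v \<Rightarrow> 'v"
  hmode :: "nat \<Rightarrow> int \<Rightarrow> 'v \<Rightarrow> 'v"
  a0 :: "'v \<Rightarrow> 'v"
  expQ :: "int \<Rightarrow> complex \<Rightarrow> 'v \<Rightarrow> 'v"

definition commutator :: "('v \<Rightarrow> 'v) \<Rightarrow> ('v \<Rightarrow> 'v) \<Rightarrow> 'v \<Rightarrow> 'v::ab_group_add" where
  "commutator A B v = A (B v) - B (A v)"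

text \<open>\<open>h\<^sub>i\<^sub>,\<^sub>0 = chi i * h\<^sub>1\<^sub>,\<^sub>0\<close> and \<open>Q\<^sub>i = chi i * Q\<^sub>1\<close>.\<close>
definition chi :: "nat \<Rightarrow> int" where
  "chi i = (if i = 1 then 1 else - 1)"

text \<open>
  The relations for \<open>expQ\<close> are the exponentiated ones: if \<open>[h, X] = c\<close> is a scalar then
  \<open>[h, exp X] = c exp X\<close>.

  The axiom \<open>diagonalisable\<close> gives meaning to \<open>z\<close> to the power \<open>h\<^sub>1\<^sub>,\<^sub>0\<close> and \<open>a\<^sub>0\<close>.
  Eigenvalues of \<open>h\<^sub>1\<^sub>,\<^sub>0\<close> are integers, so that \<open>\<Lambda>\<^sub>i(z)\<close> has integral powers of \<open>z\<close>;
  otherwise \<open>\<delta>(w/z) f(z) = \<delta>(w/z) f(w)\<close> would fail for the series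
  \<open>\<delta>(x) = \<Sum>\<^sub>n\<^sub>\<in>\<^sub>\<int> x\<^sup>n\<close>. Eigenvalues of \<open>a\<^sub>0\<close> are arbitrary.

  The axiom \<open>smooth\<close> (every vector is killed by all products of annihilation modes of large
  total degree) makes all the sums defining products of currents finite on each vector.
\<close>

locale heisenberg_module = vector_space "scl M" for M :: "'v::ab_group_add heis_module" +
  fixes p :: params
  assumes linear_hmode: "i \<in> {1, 2} \<Longrightarrow> Vector_Spaces.linear (scl M) (scl M) (hmode M i n)"
    and linear_a0: "Vector_Spaces.linear (scl M) (scl M) (a0 M)"
    and linear_expQ: "Vector_Spaces.linear (scl M) (scl M) (expQ M k t)"
    and comm_h_same: "i \<in> {1, 2} \<Longrightarrow>
      commutator (hmode M i n) (hmode M i m) v = scl M (if n + m = 0 then of_int n else 0) v"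
    and comm_h_diff: "i \<in> {1, 2} \<Longrightarrow> j \<in> {1, 2} \<Longrightarrow> i \<noteq> j \<Longrightarrow>
      commutator (hmode M i n) (hmode M j m) v =
        scl M (if n + m = 0
               then - of_int n * (q1 p powi n + q3 p powi n) / (1 + q2 p powi (- n)) else 0) v"
    and h0: "hmode M 1 0 v = - hmode M 2 0 v"
    and comm_h_a0: "i \<in> {1, 2} \<Longrightarrow> commutator (hmode M i n) (a0 M) v = 0"
    and expQ_0: "expQ M 0 0 v = v"
    and expQ_add: "expQ M (k + k') (t + t') v = expQ M k t (expQ M k' t' v)"
    and comm_h_expQ: "i \<in> {1, 2} \<Longrightarrow>
      commutator (hmode M i n) (expQ M k t) v =
        scl M (if n = 0 then of_int (chi i * k) else 0) (expQ M k t v)"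
    and comm_a0_expQ:
      "commutator (a0 M) (expQ M k t) v = scl M (t * beta p / 2) (expQ M k t v)"
    and diagonalisable:
      "v \<in> span {u. \<exists>(k::int) \<mu>. hmode M 1 0 u = scl M (of_int k) u \<and> a0 M u = scl M \<mu> u}"
    and smooth: "\<exists>N. \<forall>xs. (\<forall>(i, n) \<in> set xs. i \<in> {1, 2} \<and> n > 0) \<longrightarrow>
      N < sum_list (map snd xs) \<longrightarrow> foldr (\<lambda>(i, n). hmode M i n) xs v = 0"


section \<open>Normally ordered exponentials\<close>

text \<open>
  A value of type \<open>vexp\<close> is a linear exponent
  \[ X(z) = \sum_{i=1,2} \sum_{n \ne 0} osc_{i,n} h_{i,n} z^{-n} + Q1 \cdot Q_1 + Qa \cdot Q
       + (hlog \cdot \log z + hcst) h_{1,0} + (alog \cdot \log z + acst) a_0 \]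
  and stands for the normally ordered exponential \<open>:exp X(z):\<close>; the entries of \<open>osc\<close> at
  \<open>n = 0\<close> are never used.
\<close>

record vexp =
  osc :: "nat \<Rightarrow> int \<Rightarrow> complex"
  Q1 :: int
  Qa :: complex
  hlog :: complex
  hcst :: complex
  alog :: complex
  acst :: complex

text \<open>\<open>:exp X(z)::exp Y(z):\<close> with a common normal ordering, i.e. \<open>:exp (X(z) + Y(z)):\<close>.\<close>
definition nprod :: "vexp \<Rightarrow> vexp \<Rightarrow> vexp" where
  "nprod X Y = \<lparr> osc = (\<lambda>i n. osc X i n + osc Y i n), Q1 = Q1 X + Q1 Y, Qa = Qa X + Qa Y,
     hlog = hlog X + hlog Y, hcst = hcst X + hcst Y,
     alog = alog X + alog Y, acst = acst X + acst Y \<rparr>"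

text \<open>The substitution \<open>z \<mapsto> e\<^sup>l z\<close>, so that \<open>log z \<mapsto> log z + l\<close>.\<close>
definition rescale :: "complex \<Rightarrow> vexp \<Rightarrow> vexp" where
  "rescale l X = X\<lparr> osc := (\<lambda>i n. osc X i n * exp (- of_int n * l)),
     hcst := hcst X + l * hlog X, acst := acst X + l * alog X \<rparr>"

text \<open>
  A current \<open>A(z)\<close> is its family of coefficients: \<open>A a\<close> is the operator at \<open>z\<^sup>a\<close>. Exponents are
  complex because of the factors \<open>z\<close> to the power \<open>a\<^sub>0\<close>.
\<close>
type_synonym 'v current = "complex \<Rightarrow> 'v \<Rightarrow> 'v"

text \<open>Power and exponential of a series \<open>\<Sum>\<^sub>k Y\<^sub>k u\<^sup>k\<close> of operators with \<open>Y\<^sub>0 = 0\<close>; therefore the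
  \<open>N\<close>-th power contributes nothing to \<open>u\<^sup>k\<close> when \<open>N > k\<close>.\<close>
primrec oppow :: "(nat \<Rightarrow> 'v \<Rightarrow> 'v) \<Rightarrow> nat \<Rightarrow> nat \<Rightarrow> 'v \<Rightarrow> 'v::ab_group_add" where
  "oppow Y 0 = (\<lambda>k v. if k = 0 then v else 0)"
| "oppow Y (Suc N) = (\<lambda>k v. \<Sum>j\<le>k. Y j (oppow Y N (k - j) v))"

definition opexp ::
    "'v heis_module \<Rightarrow> (nat \<Rightarrow> 'v \<Rightarrow> 'v) \<Rightarrow> nat \<Rightarrow> 'v \<Rightarrow> 'v::ab_group_add" where
  "opexp M Y k v = (\<Sum>N\<le>k. scl M (1 / fact N) (oppow Y N k v))"

definition creation :: "'v heis_module \<Rightarrow> vexp \<Rightarrow> nat \<Rightarrow> 'v \<Rightarrow> 'v::ab_group_add" where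
  "creation M X k v =
     (if k = 0 then 0 else \<Sum>i\<in>{1, 2}. scl M (osc X i (- int k)) (hmode M i (- int k) v))"

definition annihilation :: "'v heis_module \<Rightarrow> vexp \<Rightarrow> nat \<Rightarrow> 'v \<Rightarrow> 'v::ab_group_add" where
  "annihilation M X k v =
     (if k = 0 then 0 else \<Sum>i\<in>{1, 2}. scl M (osc X i (int k)) (hmode M i (int k) v))"

text \<open>\<open>wt M v (k, \<mu>)\<close> is the component of \<open>v\<close> with \<open>h\<^sub>1\<^sub>,\<^sub>0 = k\<close>, \<open>a\<^sub>0 = \<mu>\<close>.\<close>
definition wt :: "'v heis_module \<Rightarrow> 'v \<Rightarrow> int \<times> complex \<Rightarrow> 'v::ab_group_add" where
  "wt M v = (THE f. finite {x. f x \<noteq> 0} \<and>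
     (\<forall>k \<mu>. hmode M 1 0 (f (k, \<mu>)) = scl M (of_int k) (f (k, \<mu>)) \<and>
            a0 M (f (k, \<mu>)) = scl M \<mu> (f (k, \<mu>))) \<and>
     Sum_any f = v)"

text \<open>Coefficient of \<open>z\<^sup>b\<close> in
  \<open>exp ((hlog log z + hcst) h\<^sub>1\<^sub>,\<^sub>0 + (alog log z + acst) a\<^sub>0)\<close>.\<close>
definition zero_modes :: "'v heis_module \<Rightarrow> vexp \<Rightarrow> ('v::ab_group_add) current" where
  "zero_modes M X b v = Sum_any (\<lambda>(k, \<mu>).
     if hlog X * of_int k + alog X * \<mu> = b
     then scl M (exp (hcst X * of_int k + acst X * \<mu>)) (wt M v (k, \<mu>)) else 0)"

text \<open>The coefficients of \<open>:exp X(z):\<close>; \<open>j\<close> and \<open>l\<close> are the powers of \<open>z\<close> and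
  \<open>z\<^sup>-\<^sup>1\<close> taken from the creation and the annihilation part.\<close>
definition vertex :: "'v heis_module \<Rightarrow> vexp \<Rightarrow> ('v::ab_group_add) current" where
  "vertex M X a v = Sum_any (\<lambda>(j, l).
     opexp M (creation M X) j (opexp M (annihilation M X) l
       (expQ M (Q1 X) (Qa X) (zero_modes M X (a - of_nat j + of_nat l) v))))"


section \<open>The currents\<close>

definition Lambda_plus :: "params \<Rightarrow> nat \<Rightarrow> vexp" where
  "Lambda_plus p i = \<lparr> osc = (\<lambda>j n. if j = i then - (qq p powi n / of_int n) else 0),
     Q1 = chi i, Qa = 0,
     hlog = of_int (chi i), hcst = of_int (chi i) * (- log_q p),
     alog = 0, acst = hbar p \<rparr>"

definition Lambda_minus :: "params \<Rightarrow> nat \<Rightarrow> vexp" where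
  "Lambda_minus p i = \<lparr> osc = (\<lambda>j n. if j = i then qq p powi (- n) / of_int n else 0),
     Q1 = - chi i, Qa = 0,
     hlog = - of_int (chi i), hcst = - of_int (chi i) * log_q p,
     alog = 0, acst = - hbar p \<rparr>"

text \<open>\<open>S\<^sub>i\<close> carries \<open>\<gamma>\<^sub>m\<close> without the factor \<open>s\<^sup>m\<close> on the creation modes of \<open>h\<^sub>i\<close> and on
  the annihilation modes of the other boson.\<close>
definition Screen :: "params \<Rightarrow> pm \<Rightarrow> nat \<Rightarrow> vexp" where
  "Screen p \<sigma> i = \<lparr> osc = (\<lambda>j n. gam p \<sigma> \<bar>n\<bar> * (if n < 0 \<longleftrightarrow> j = i then 1 else s p \<sigma> powi \<bar>n\<bar>)),
     Q1 = chi i, Qa = tau p \<sigma>,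
     hlog = of_int (chi i), hcst = 0,
     alog = 2 * tau p \<sigma>, acst = 0 \<rparr>"

definition W :: "params \<Rightarrow> 'v heis_module \<Rightarrow> nat \<Rightarrow> ('v::ab_group_add) current" where
  "W p M i = (\<lambda>a v. vertex M (Lambda_plus p i) a v + vertex M (Lambda_minus p i) a v)"

definition S :: "params \<Rightarrow> 'v heis_module \<Rightarrow> pm \<Rightarrow> ('v::ab_group_add) current" where
  "S p M \<sigma> = (\<lambda>a v. vertex M (Screen p \<sigma> 1) a v - vertex M (Screen p \<sigma> 2) a v)"


section \<open>Formal series in \<open>z\<close> and \<open>w\<close>\<close>

text \<open>\<open>F a b\<close> is the operator at \<open>z\<^sup>a w\<^sup>b\<close>. Since products of currents are compositions of
  coefficients acting on a smooth module, the contraction in \<open>A(z) B(w)\<close> automatically appears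
  expanded in nonnegative powers of \<open>w/z\<close>, and that in \<open>B(w) A(z)\<close> in nonnegative powers of \<open>z/w\<close>.\<close>
type_synonym 'v current2 = "complex \<Rightarrow> complex \<Rightarrow> 'v \<Rightarrow> 'v"

definition anticommutator :: "'v current \<Rightarrow> 'v current \<Rightarrow> ('v::ab_group_add) current2" where
  "anticommutator A B = (\<lambda>a b v. A a (B b v) + B b (A a v))"

text \<open>\<open>\<delta>(w / (e\<^sup>l z)) N(w) = \<Sum>\<^sub>n\<^sub>\<in>\<^sub>\<int> e\<^sup>-\<^sup>n\<^sup>l z\<^sup>-\<^sup>n w\<^sup>n N(w)\<close>\<close>
definition delta_times ::
    "'v heis_module \<Rightarrow> complex \<Rightarrow> 'v current \<Rightarrow> ('v::ab_group_add) current2" where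
  "delta_times M l N = (\<lambda>a b v. Sum_any (\<lambda>n::int.
     if a = - of_int n then scl M (exp (- of_int n * l)) (N (b - of_int n) v) else 0))"

text \<open>\<open>F(z, w) \<mapsto> F(z, e\<^sup>l w)\<close>\<close>
definition shift_w ::
    "'v heis_module \<Rightarrow> complex \<Rightarrow> 'v current2 \<Rightarrow> ('v::ab_group_add) current2" where
  "shift_w M l F = (\<lambda>a b v. scl M (exp (b * l)) (F a b v))"

text \<open>\<open>F(z, w) \<mapsto> w\<^sup>-\<^sup>1 F(z, w)\<close>\<close>
definition w_inverse_times :: "'v current2 \<Rightarrow> 'v current2" where
  "w_inverse_times F = (\<lambda>a b. F a (b + 1))"

end

theory Submission
  imports Defs
begin

text \<open>
  Write \<open>x = s\<^sup>1\<^sup>/\<^sup>2\<close> for the chosen \<open>s = s\<^sub>\<plusminus>\<close>, and \<open>y\<close> for the corresponding square root of the other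
  one of \<open>q\<^sub>1\<close>, \<open>q\<^sub>3\<close>, so that \<open>q = 1 / (x y)\<close>. By Wick's theorem a product of two vertex operators is
  a scalar series times their normally ordered product, and for \<open>\<Lambda>\<^sub>i\<^sup>\<plusminus>(z)\<close> and \<open>S\<^sub>j(w)\<close> this series
  is of one of two kinds.

  \<^item> For \<open>\<Lambda>\<^sub>i\<^sup>+\<close> with \<open>S\<^sub>i\<close>, and for \<open>\<Lambda>\<^sub>i\<^sup>-\<close> with \<open>S\<^sub>j\<close> (\<open>j \<noteq> i\<close>), the series is a polynomial
    \<open>r\<^sup>-\<^sup>1 z - w\<close>, and its negative appears in the opposite order. These pairs anticommute
    (\<open>anticommutator_eq_0\<close>).

  \<^item> For \<open>\<Lambda>\<^sub>i\<^sup>+\<close> with \<open>S\<^sub>j\<close> (\<open>r = x\<^sup>-\<^sup>1\<close>), and for \<open>\<Lambda>\<^sub>i\<^sup>-\<close> with \<open>S\<^sub>i\<close> (\<open>r = x\<close>), the two orders give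
    the expansions of \<open>1 / (r\<^sup>-\<^sup>1 z - w)\<close> and of its negative in opposite regions. The sum is
    \<open>w\<^sup>-\<^sup>1 \<delta>(r w / z)\<close>, which also sets \<open>z = r w\<close> in the normally ordered product
    (\<open>anticommutator_eq_delta\<close>).

  The two delta terms of the second kind are related by the shift \<open>w \<mapsto> s w\<close>, because
  \<open>:\<Lambda>\<^sub>i\<^sup>-(x w) S\<^sub>i(w): = :\<Lambda>\<^sub>i\<^sup>+(x w) S\<^sub>j(s w):\<close> holds already for the exponents (\<open>vertex_fused\<close>). As
  \<open>S\<^sub>1\<close> and \<open>S\<^sub>2\<close> enter \<open>S\<close> with opposite signs, the two terms form the difference on the right.

  The analytic content of Wick's theorem is obtained without multiplying infinite series. The
  coefficients \<open>E\<^sub>k\<close> of \<open>exp Y(u)\<close>, where \<open>Y(u) = \<Sum> Y\<^sub>j u\<^sup>j\<close> has commuting coefficients, are characterised by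
  the Euler recursion \<open>k E\<^sub>k = \<Sum>\<^sub>j j Y\<^sub>j E\<^sub>k\<^sub>-\<^sub>j\<close> (\<open>opexp_euler\<close>, \<open>opexp_unique\<close>). Multiplicativity of exp, and
  the exchange of annihilation and creation exponentials, are checked on this recursion. On a
  vector of definite weight for \<open>h\<^sub>1\<^sub>,\<^sub>0\<close> and \<open>a\<^sub>0\<close> only finitely many annihilation terms survive, so
  each coefficient of a vertex operator is an explicit finite sum there (\<open>vertex_weight\<close>), and such
  vectors span the module.
\<close>

section \<open>Rearranging triangular sums\<close>

lemma sum_diagonals:
  fixes f :: "nat \<Rightarrow> nat \<Rightarrow> 'a::comm_monoid_add"
  shows "(\<Sum>i\<le>k. \<Sum>j\<le>i. f j (i - j)) = (\<Sum>j\<le>k. \<Sum>i\<le>k - j. f j i)"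
  unfolding sum.Sigma[OF finite_atMost ballI[OF finite_atMost]]
  by (rule sum.reindex_bij_witness[of _ "\<lambda>(j, i). (j + i, j)" "\<lambda>(i, j). (j, i - j)"]) auto

lemma sum_triangle_swap:
  fixes f :: "nat \<Rightarrow> nat \<Rightarrow> 'a::comm_monoid_add"
  shows "(\<Sum>j\<le>k. \<Sum>i\<le>k - j. f j i) = (\<Sum>i\<le>k. \<Sum>j\<le>k - i. f j i)"
  unfolding sum.Sigma[OF finite_atMost ballI[OF finite_atMost]]
  by (rule sum.reindex_bij_witness[of _ "\<lambda>(j, i). (i, j)" "\<lambda>(i, j). (j, i)"]) auto

text \<open>Summation by total degree up to a large cutoff is a summation over a rectangle that contains the
  support. This lets the cutoff in a product of vertex operators be chosen freely.\<close>
lemma sum_diagonals_rectangle: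
  fixes f :: "nat \<Rightarrow> nat \<Rightarrow> 'a::comm_monoid_add"
  assumes "\<And>j i. j \<le> K \<Longrightarrow> i \<le> L \<Longrightarrow> k < j + i \<Longrightarrow> f j i = 0"
    and "\<And>j i. K < j \<or> L < i \<Longrightarrow> f j i = 0"
  shows "(\<Sum>i\<le>k. \<Sum>j\<le>i. f j (i - j)) = (\<Sum>j\<le>K. \<Sum>i\<le>L. f j i)"
proof -
  let ?g = "\<lambda>(j, i). f j i"
  have "(\<Sum>i\<le>k. \<Sum>j\<le>i. f j (i - j)) = sum ?g (SIGMA j:{..k}. {..k - j})"
    unfolding sum_diagonals by (simp add: sum.Sigma)
  also have "\<dots> = sum ?g ((SIGMA j:{..k}. {..k - j}) \<union> {..K} \<times> {..L})"
    by (rule sum.mono_neutral_left) (auto intro: assms(1))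
  also have "\<dots> = sum ?g ({..K} \<times> {..L})"
    by (rule sum.mono_neutral_right) (auto intro: assms(2))
  also have "\<dots> = (\<Sum>j\<le>K. \<Sum>i\<le>L. f j i)"
    by (simp add: sum.cartesian_product)
  finally show ?thesis .
qed

section \<open>Exponentials of commuting families of operators\<close>

context heisenberg_module
begin

abbreviation lin :: "('v \<Rightarrow> 'v) \<Rightarrow> bool" where
  "lin \<equiv> Vector_Spaces.linear (scl M) (scl M)"

lemma lin_facts:
  assumes "lin f"
  shows lin_add: "f (x + y) = f x + f y" and lin_scale: "f (scl M c x) = scl M c (f x)"
    and lin_zero: "f 0 = 0" and lin_sum: "f (sum g A) = (\<Sum>a\<in>A. f (g a))"
    and lin_diff: "f (x - y) = f x - f y"
proof -
  interpret L: Vector_Spaces.linear "scl M" "scl M" f by fact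
  show "f (x + y) = f x + f y" "f (scl M c x) = scl M c (f x)" "f 0 = 0"
    "f (sum g A) = (\<Sum>a\<in>A. f (g a))" "f (x - y) = f x - f y"
    by (simp_all add: L.add L.scale L.sum L.diff)
qed

lemma linI:
  assumes "\<And>x y. f (x + y) = f x + f y" and "\<And>c x. f (scl M c x) = scl M c (f x)"
  shows "lin f"
  using assms vector_space_axioms
  by (simp add: Vector_Spaces.linear_def module_hom_def module_hom_axioms_def module_iff_vector_space)

lemma lin_sum_scale:
  assumes "\<And>a. a \<in> A \<Longrightarrow> lin (f a)"
  shows "lin (\<lambda>v. \<Sum>a\<in>A. scl M (c a) (f a v))"
  by (rule linI)
    (simp_all add: lin_facts(1,2)[OF assms] scale_right_distrib sum.distrib scale_sum_right mult.commute)

lemma lin_compose: "lin f \<Longrightarrow> lin g \<Longrightarrow> lin (\<lambda>v. f (g v))"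
  by (rule linI) (simp_all add: lin_facts)

lemma lin_oppow:
  assumes "\<And>j. lin (Y j)"
  shows "lin (oppow Y N k)"
proof (induction N arbitrary: k)
  case 0
  show ?case by (rule linI) simp_all
next
  case (Suc N)
  have "lin (\<lambda>v. \<Sum>j\<in>{..k}. scl M 1 (Y j (oppow Y N (k - j) v)))"
    by (rule lin_sum_scale) (rule lin_compose[OF assms Suc.IH])
  then show ?case by simp
qed

lemma lin_opexp:
  assumes "\<And>j. lin (Y j)"
  shows "lin (opexp M Y k)"
  unfolding opexp_def[abs_def] by (rule lin_sum_scale) (rule lin_oppow[OF assms])

lemma oppow_commute:
  assumes "lin T" and "\<And>j. lin (Y j)" and "\<And>j v. T (Y j v) = Y j (T v)"
  shows "T (oppow Y N k v) = oppow Y N k (T v)"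
  by (induction N arbitrary: k) (simp_all add: lin_facts[OF assms(1)] assms(3))

lemma opexp_commute:
  assumes "lin T" and "\<And>j. lin (Y j)" and "\<And>j v. T (Y j v) = Y j (T v)"
  shows "T (opexp M Y k v) = opexp M Y k (T v)"
  by (simp add: opexp_def lin_facts[OF assms(1)] oppow_commute[OF assms])

lemma opexp_0: "opexp M Y 0 v = v"
  by (simp add: opexp_def)

lemma oppow_eq_0:
  assumes "\<And>j. lin (Y j)" and "\<And>v. Y 0 v = 0" and "k < N"
  shows "oppow Y N k v = 0"
  using \<open>k < N\<close>
proof (induction N arbitrary: k)
  case (Suc N)
  have "Y j (oppow Y N (k - j) v) = 0" if "j \<le> k" for j
  proof (cases "j = 0")
    case False
    then have "k - j < N" using Suc.prems that by simp
    then show ?thesis by (simp add: Suc.IH lin_facts[OF assms(1)])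
  qed (simp add: assms)
  then show ?case by simp
qed simp

text \<open>The operator \<open>u d/du\<close> applied to \<open>Y(u)\<^sup>N\<^sup>+\<^sup>1\<close>: since the coefficients commute, the product rule
  gives \<open>(N + 1) (u Y'(u)) Y(u)\<^sup>N\<close>.\<close>
lemma oppow_euler:
  assumes Y: "\<And>j. lin (Y j)" and comm: "\<And>i j v. Y i (Y j v) = Y j (Y i v)"
  shows "scl M (of_nat k) (oppow Y (Suc N) k v) =
    scl M (of_nat (Suc N)) (\<Sum>j\<le>k. scl M (of_nat j) (Y j (oppow Y N (k - j) v)))"
proof (induction N arbitrary: k)
  case 0
  have "Y j (oppow Y 0 (k - j) v) = (if j = k then Y k v else 0)" if "j \<le> k" for j
    using that by (auto simp: lin_facts[OF Y])
  then show ?case by (simp add: if_distrib[of "scl M c" for c] sum.delta cong: if_cong)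
next
  case (Suc N)
  let ?P = "oppow Y"
  have "scl M (of_nat k) (?P (Suc (Suc N)) k v) =
      (\<Sum>j\<le>k. scl M (of_nat j + of_nat (k - j)) (Y j (?P (Suc N) (k - j) v)))"
    by (simp add: scale_sum_right flip: of_nat_add del: oppow.simps(1))
  also have "\<dots> = (\<Sum>j\<le>k. scl M (of_nat j) (Y j (?P (Suc N) (k - j) v)))
      + (\<Sum>j\<le>k. Y j (scl M (of_nat (k - j)) (?P (Suc N) (k - j) v)))"
    by (simp add: scale_left_distrib sum.distrib lin_facts[OF Y] del: oppow.simps of_nat_diff)
  also have "(\<Sum>j\<le>k. Y j (scl M (of_nat (k - j)) (?P (Suc N) (k - j) v))) =
      (\<Sum>j\<le>k. \<Sum>i\<le>k - j. scl M (of_nat (Suc N) * of_nat i) (Y j (Y i (?P N (k - j - i) v))))"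
    unfolding Suc.IH by (simp add: lin_facts[OF Y] scale_sum_right del: oppow.simps)
  also have "\<dots> = (\<Sum>j\<le>k. \<Sum>i\<le>k - j. scl M (of_nat (Suc N) * of_nat j) (Y j (Y i (?P N (k - j - i) v))))"
    by (subst sum_triangle_swap) (simp add: comm add.commute)
  also have "\<dots> = scl M (of_nat (Suc N)) (\<Sum>j\<le>k. scl M (of_nat j) (Y j (?P (Suc N) (k - j) v)))"
    by (simp add: lin_facts[OF Y] scale_sum_right)
  finally show ?case
    by (simp add: scale_left_distrib of_nat_Suc[of "Suc N"] del: of_nat_Suc oppow.simps)
qed

text \<open>The differential equation \<open>u d/du exp Y(u) = (u Y'(u)) exp Y(u)\<close>, coefficientwise.\<close>
lemma opexp_euler:
  assumes Y: "\<And>j. lin (Y j)" and Y0: "\<And>v. Y 0 v = 0" and comm: "\<And>i j v. Y i (Y j v) = Y j (Y i v)"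
  shows "scl M (of_nat k) (opexp M Y k v) = (\<Sum>j\<le>k. scl M (of_nat j) (Y j (opexp M Y (k - j) v)))"
proof (cases k)
  case 0
  then show ?thesis by (simp add: Y0)
next
  case (Suc n)
  have fct: "(1 / fact (Suc N) * of_nat (Suc N) :: complex) = 1 / fact N" for N
    by (simp add: field_simps del: of_nat_Suc)
  have opexp_upto: "opexp M Y i v = (\<Sum>N\<le>m. scl M (1 / fact N) (oppow Y N i v))" if "i \<le> m" for i m
    unfolding opexp_def
    by (rule sum.mono_neutral_left) (use that in \<open>auto simp: oppow_eq_0[where Y=Y, OF Y Y0]\<close>)
  have "scl M (of_nat k) (opexp M Y k v) =
      (\<Sum>N\<le>Suc n. scl M (1 / fact N) (scl M (of_nat k) (oppow Y N k v)))"
    unfolding opexp_def Suc by (simp add: scale_sum_right mult.commute del: sum.atMost_Suc oppow.simps)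
  also have "\<dots> = (\<Sum>N\<le>n. scl M (1 / fact (Suc N)) (scl M (of_nat k) (oppow Y (Suc N) k v)))"
    unfolding sum.atMost_Suc_shift using Suc by (simp del: oppow.simps(2) fact_Suc)
  also have "\<dots> = (\<Sum>N\<le>n. scl M (1 / fact N) (\<Sum>j\<le>k. scl M (of_nat j) (Y j (oppow Y N (k - j) v))))"
    unfolding oppow_euler[where Y=Y, OF Y comm] scale_scale fct ..
  also have "\<dots> = (\<Sum>j\<le>k. scl M (of_nat j) (Y j (\<Sum>N\<le>n. scl M (1 / fact N) (oppow Y N (k - j) v))))"
    unfolding scale_sum_right lin_sum[OF Y] by (subst sum.swap) (simp add: lin_facts[OF Y] mult.commute)
  also have "\<dots> = (\<Sum>j\<le>k. scl M (of_nat j) (Y j (opexp M Y (k - j) v)))"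
  proof (rule sum.cong)
    fix j assume "j \<in> {..k}"
    show "scl M (of_nat j) (Y j (\<Sum>N\<le>n. scl M (1 / fact N) (oppow Y N (k - j) v))) =
        scl M (of_nat j) (Y j (opexp M Y (k - j) v))"
      by (cases "j = 0") (auto simp: Y0 Suc opexp_upto[of "Suc n - j" n])
  qed simp
  finally show ?thesis .
qed

text \<open>The Euler recursion determines all coefficients from the one at \<open>u\<^sup>0\<close>, because \<open>k > 0\<close> can be
  divided out. This is how identities between exponentials are proved below.\<close>
lemma opexp_unique:
  assumes Y: "\<And>j. lin (Y j)" and Y0: "\<And>v. Y 0 v = 0" and comm: "\<And>i j v. Y i (Y j v) = Y j (Y i v)"
    and g0: "g 0 = v"
    and g: "\<And>k. scl M (of_nat k) (g k) = (\<Sum>j\<le>k. scl M (of_nat j) (Y j (g (k - j))))"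
  shows "g k = opexp M Y k v"
proof (induction k rule: less_induct)
  case (less k)
  show ?case
  proof (cases "k = 0")
    case False
    have "scl M (of_nat k) (g k) = scl M (of_nat k) (opexp M Y k v)"
      unfolding g opexp_euler[where Y=Y, OF Y Y0 comm]
    proof (rule sum.cong)
      fix j assume "j \<in> {..k}"
      show "scl M (of_nat j) (Y j (g (k - j))) = scl M (of_nat j) (Y j (opexp M Y (k - j) v))"
        using False by (cases "j = 0") (auto simp: Y0 less.IH)
    qed simp
    then show ?thesis using False by simp
  qed (simp add: g0 opexp_0)
qed

text \<open>\<open>exp (Y(c u) + Y'(u)) = exp Y(c u) exp Y'(u)\<close>: by the product rule for \<open>u d/du\<close> the right side
  satisfies the Euler recursion of the left side. The scale \<open>c\<close> accommodates the substitution of a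
  multiple of \<open>w\<close> for \<open>z\<close>.\<close>
lemma opexp_fuse:
  assumes Y: "\<And>j. lin (Y j)" and Y0: "\<And>v. Y 0 v = 0" and Ycomm: "\<And>i j v. Y i (Y j v) = Y j (Y i v)"
    and Y': "\<And>j. lin (Y' j)" and Y'0: "\<And>v. Y' 0 v = 0"
    and Y'comm: "\<And>i j v. Y' i (Y' j v) = Y' j (Y' i v)"
    and comm: "\<And>i j v. Y i (Y' j v) = Y' j (Y i v)"
    and Z: "\<And>j v. Z j v = scl M (c ^ j) (Y j v) + Y' j v"
  shows "opexp M Z k v = (\<Sum>i\<le>k. scl M (c ^ i) (opexp M Y i (opexp M Y' (k - i) v)))"
proof -
  define g where "g k = (\<Sum>i\<le>k. scl M (c ^ i) (opexp M Y i (opexp M Y' (k - i) v)))" for k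
  have linZ: "lin (Z j)" for j
    by (rule linI) (simp_all add: Z lin_facts[OF Y] lin_facts[OF Y'] scale_right_distrib mult.commute
        algebra_simps)
  have commE: "Y' j (opexp M Y i w) = opexp M Y i (Y' j w)" for i j w
    by (rule opexp_commute[where T="Y' j" and Y=Y, OF Y' Y]) (simp add: comm)
  have "g k = opexp M Z k v"
  proof (rule opexp_unique[OF linZ])
    show "Z 0 w = 0" for w by (simp add: Z Y0 Y'0)
    show "Z i (Z j w) = Z j (Z i w)" for i j w
      by (simp add: Z lin_facts[OF Y] lin_facts[OF Y'] Ycomm[of i j] Y'comm[of i j] comm[of i j] comm[of j i]
          scale_right_distrib mult.commute algebra_simps)
    show "g 0 = v" by (simp add: g_def opexp_0)
    fix k
    let ?E = "opexp M Y" and ?E' = "opexp M Y'"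
    note simps = scale_sum_right lin_facts[OF Y] lin_facts[OF Y'] lin_facts[OF lin_opexp[OF Y]]
    have "scl M (of_nat k) (g k) = (\<Sum>i\<le>k. scl M (c ^ i) (scl M (of_nat i + of_nat (k - i)) (?E i (?E' (k - i) v))))"
      unfolding g_def by (simp add: scale_sum_right mult.commute flip: of_nat_add)
    also have "\<dots> = (\<Sum>i\<le>k. scl M (c ^ i) (scl M (of_nat i) (?E i (?E' (k - i) v))))
        + (\<Sum>i\<le>k. scl M (c ^ i) (?E i (scl M (of_nat (k - i)) (?E' (k - i) v))))"
      by (simp add: simps scale_left_distrib scale_right_distrib sum.distrib del: of_nat_diff)
    also have "(\<Sum>i\<le>k. scl M (c ^ i) (scl M (of_nat i) (?E i (?E' (k - i) v)))) =
        (\<Sum>i\<le>k. \<Sum>j\<le>i. scl M (c ^ (j + (i - j)) * of_nat j) (Y j (?E (i - j) (?E' (k - (j + (i - j))) v))))"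
      unfolding opexp_euler[where Y=Y, OF Y Y0 Ycomm] by (simp add: scale_sum_right)
    also have "\<dots> = (\<Sum>j\<le>k. scl M (of_nat j) (scl M (c ^ j) (Y j (g (k - j)))))"
      unfolding sum_diagonals[of "\<lambda>j i. scl M (c ^ (j + i) * of_nat j) (Y j (?E i (?E' (k - (j + i)) v)))"]
      by (simp add: g_def simps power_add mult_ac)
    also have "(\<Sum>i\<le>k. scl M (c ^ i) (?E i (scl M (of_nat (k - i)) (?E' (k - i) v)))) =
       (\<Sum>i\<le>k. \<Sum>j\<le>k - i. scl M (c ^ i * of_nat j) (Y' j (?E i (?E' (k - i - j) v))))"
      unfolding opexp_euler[where Y=Y', OF Y' Y'0 Y'comm] by (simp add: simps commE)
    also have "\<dots> = (\<Sum>j\<le>k. scl M (of_nat j) (Y' j (g (k - j))))"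
      by (subst sum_triangle_swap) (simp add: g_def simps mult_ac add.commute)
    finally show "scl M (of_nat k) (g k) = (\<Sum>j\<le>k. scl M (of_nat j) (Z j (g (k - j))))"
      by (simp add: Z scale_right_distrib sum.distrib)
  qed
  then show ?thesis by (simp add: g_def)
qed

text \<open>Moving an annihilation operator across a creation exponential lowers the degree of the latter,
  possibly below zero. Extending the coefficients by zero to negative degrees removes the resulting
  case distinctions.\<close>
definition opexp_int :: "(nat \<Rightarrow> 'v \<Rightarrow> 'v) \<Rightarrow> int \<Rightarrow> 'v \<Rightarrow> 'v" where
  "opexp_int Y n v = (if n < 0 then 0 else opexp M Y (nat n) v)"

lemma lin_opexp_int:
  assumes "\<And>j. lin (Y j)"
  shows "lin (opexp_int Y n)"
  unfolding opexp_int_def[abs_def] by (rule linI) (simp_all add: lin_facts[OF lin_opexp[OF assms]])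

lemma opexp_int_euler:
  assumes Y: "\<And>j. lin (Y j)" and Y0: "\<And>v. Y 0 v = 0" and comm: "\<And>i j v. Y i (Y j v) = Y j (Y i v)"
    and "n \<le> int K"
  shows "scl M (of_int n) (opexp_int Y n v) = (\<Sum>j\<le>K. scl M (of_nat j) (Y j (opexp_int Y (n - int j) v)))"
proof (cases "n < 0")
  case True
  then show ?thesis by (simp add: opexp_int_def lin_facts[OF Y])
next
  case False
  then have "scl M (of_int n) (opexp_int Y n v) = scl M (of_nat (nat n)) (opexp M Y (nat n) v)"
    by (simp add: opexp_int_def)
  also have "\<dots> = (\<Sum>j\<le>nat n. scl M (of_nat j) (Y j (opexp M Y (nat n - j) v)))"
    by (rule opexp_euler) fact+
  also have "\<dots> = (\<Sum>j\<le>nat n. scl M (of_nat j) (Y j (opexp_int Y (n - int j) v)))"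
    using False by (intro sum.cong) (auto simp: opexp_int_def nat_diff_distrib)
  also have "\<dots> = (\<Sum>j\<le>K. scl M (of_nat j) (Y j (opexp_int Y (n - int j) v)))"
    using \<open>n \<le> int K\<close> by (intro sum.mono_neutral_left) (auto simp: opexp_int_def lin_facts[OF Y])
  finally show ?thesis .
qed

text \<open>As \<open>[A, C(u)] = c u\<^sup>l\<close> is a scalar, \<open>A\<close> acts on \<open>exp C(u)\<close> as a derivation:
  \<open>[A, exp C(u)] = c u\<^sup>l exp C(u)\<close>.\<close>
lemma annihilator_past_opexp:
  assumes C: "\<And>j. lin (C j)" and C0: "\<And>v. C 0 v = 0" and Ccomm: "\<And>i j v. C i (C j v) = C j (C i v)"
    and A: "lin A"
    and AC: "\<And>j v. A (C j v) = C j (A v) + scl M (if j = l then c else 0) v"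
  shows "A (opexp_int C n v) = opexp_int C n (A v) + scl M c (opexp_int C (n - int l) v)"
proof (cases "n < 0")
  case True
  then show ?thesis by (simp add: opexp_int_def lin_facts[OF A])
next
  case False
  have "A (opexp_int C (int k) v) = opexp_int C (int k) (A v) + scl M c (opexp_int C (int k - int l) v)" for k
  proof (induction k rule: less_induct)
    case (less k)
    let ?E = "opexp_int C"
    show ?case
    proof (cases "k = 0")
      case True
      show ?thesis
      proof (cases "l = 0")
        case True
        then have "scl M c v = 0" using AC[of 0 v] by (simp add: C0 lin_facts[OF A])
        with \<open>k = 0\<close> True show ?thesis by (simp add: opexp_int_def opexp_0)
      qed (simp add: \<open>k = 0\<close> opexp_int_def opexp_0)
    next
      case False
      have "scl M (of_nat k) (A (?E (int k) v)) = A (scl M (of_int (int k)) (?E (int k) v))"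
        by (simp add: lin_facts[OF A])
      also have "\<dots> = (\<Sum>j\<le>k. scl M (of_nat j) (A (C j (?E (int k - int j) v))))"
        by (subst opexp_int_euler[where Y=C and K=k, OF C C0 Ccomm]) (simp_all add: lin_facts[OF A])
      also have "\<dots> = (\<Sum>j\<le>k. scl M (of_nat j) (C j (A (?E (int k - int j) v))))
          + (\<Sum>j\<le>k. if j = l then scl M (of_nat j * c) (?E (int k - int j) v) else 0)"
        unfolding AC by (simp add: scale_right_distrib sum.distrib if_distrib[of "\<lambda>c. scl M (_ * c) _"] cong: if_cong)
      also have "(\<Sum>j\<le>k. if j = l then scl M (of_nat j * c) (?E (int k - int j) v) else 0) =
          scl M (of_nat l * c) (?E (int k - int l) v)"
        by (simp add: opexp_int_def)
      also have "(\<Sum>j\<le>k. scl M (of_nat j) (C j (A (?E (int k - int j) v)))) =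
          (\<Sum>j\<le>k. scl M (of_nat j) (C j (?E (int k - int j) (A v) + scl M c (?E (int k - int l - int j) v))))"
      proof (rule sum.cong)
        fix j assume "j \<in> {..k}"
        then show "scl M (of_nat j) (C j (A (?E (int k - int j) v))) =
           scl M (of_nat j) (C j (?E (int k - int j) (A v) + scl M c (?E (int k - int l - int j) v)))"
          using less.IH[of "k - j"] False by (cases "j = 0") (auto simp: C0 of_nat_diff algebra_simps)
      qed simp
      also have "\<dots> = (\<Sum>j\<le>k. scl M (of_nat j) (C j (?E (int k - int j) (A v))))
           + scl M c (\<Sum>j\<le>k. scl M (of_nat j) (C j (?E (int k - int l - int j) v)))"
        by (simp add: lin_facts[OF C] scale_right_distrib sum.distrib scale_sum_right mult.commute)
      also have "\<dots> = scl M (of_int (int k)) (?E (int k) (A v))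
           + scl M c (scl M (of_int (int k - int l)) (?E (int k - int l) v))"
        by (subst (1 2) opexp_int_euler[where Y=C and K=k, OF C C0 Ccomm]) simp_all
      finally have "scl M (of_nat k) (A (?E (int k) v)) =
          scl M (of_nat k) (?E (int k) (A v) + scl M c (?E (int k - int l) v))"
        by (simp add: algebra_simps scale_left_distrib scale_left_diff_distrib scale_right_distrib)
      then show ?thesis using False by simp
    qed
  qed
  from this[of "nat n"] False show ?thesis by simp
qed

text \<open>The formula \<open>exp A(t) exp C(u) = \<kappa>(t u) exp C(u) exp A(t)\<close> with \<open>\<kappa>(t) = exp (\<Sum>\<^sub>i c\<^sub>i t\<^sup>i)\<close>. The scalar
  series \<open>\<kappa>\<close> is given through its own Euler recursion, so that its closed form can be supplied
  directly in applications.\<close>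
lemma opexp_past_opexp:
  assumes C: "\<And>j. lin (C j)" and C0: "\<And>v. C 0 v = 0" and Ccomm: "\<And>i j v. C i (C j v) = C j (C i v)"
    and A: "\<And>j. lin (A j)" and A0: "\<And>v. A 0 v = 0" and Acomm: "\<And>i j v. A i (A j v) = A j (A i v)"
    and AC: "\<And>i j v. A i (C j v) = C j (A i v) + scl M (if j = i then c i else 0) v"
    and \<kappa>0: "\<kappa> 0 = 1" and \<kappa>: "\<And>k. of_nat k * \<kappa> k = (\<Sum>i\<le>k. of_nat i * c i * \<kappa> (k - i))"
  shows "opexp M A l (opexp_int C n v) = (\<Sum>m\<le>l. scl M (\<kappa> m) (opexp_int C (n - int m) (opexp M A (l - m) v)))"
proof (rule sym, rule opexp_unique[where Y=A, OF A A0 Acomm])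
  let ?E = "opexp_int C" and ?F = "opexp M A"
  note simps = scale_sum_right lin_facts[OF C] lin_facts[OF A] lin_facts[OF lin_opexp_int[where Y=C, OF C]]
  show "(\<Sum>m\<le>0. scl M (\<kappa> m) (?E (n - int m) (?F (0 - m) v))) = ?E n v"
    by (simp add: \<kappa>0 opexp_0)
  fix k
  have "(\<Sum>j\<le>k. scl M (of_nat j) (A j (\<Sum>m\<le>k - j. scl M (\<kappa> m) (?E (n - int m) (?F (k - j - m) v))))) =
    (\<Sum>j\<le>k. \<Sum>m\<le>k - j. scl M (of_nat j * \<kappa> m) (?E (n - int m) (A j (?F (k - j - m) v)))) +
    (\<Sum>j\<le>k. \<Sum>m\<le>k - j. scl M (of_nat j * c j * \<kappa> m) (?E (n - int (j + m)) (?F (k - (j + m)) v)))"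
    by (simp add: simps annihilator_past_opexp[where C=C, OF C C0 Ccomm A AC] scale_right_distrib sum.distrib mult_ac
        diff_diff_eq add.commute)
  also have "(\<Sum>j\<le>k. \<Sum>m\<le>k - j. scl M (of_nat j * \<kappa> m) (?E (n - int m) (A j (?F (k - j - m) v)))) =
     (\<Sum>m\<le>k. scl M (\<kappa> m) (?E (n - int m) (\<Sum>j\<le>k - m. scl M (of_nat j) (A j (?F (k - m - j) v)))))"
    by (subst sum_triangle_swap) (simp add: simps mult_ac add.commute)
  also have "\<dots> = (\<Sum>m\<le>k. scl M (\<kappa> m * of_nat (k - m)) (?E (n - int m) (?F (k - m) v)))"
    unfolding opexp_euler[where Y=A, OF A A0 Acomm, symmetric] by (simp add: simps)
  also have "(\<Sum>j\<le>k. \<Sum>m\<le>k - j. scl M (of_nat j * c j * \<kappa> m) (?E (n - int (j + m)) (?F (k - (j + m)) v))) =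
     (\<Sum>m\<le>k. \<Sum>j\<le>m. scl M (of_nat j * c j * \<kappa> (m - j)) (?E (n - int (j + (m - j))) (?F (k - (j + (m - j))) v)))"
    by (rule sum_diagonals[symmetric])
  also have "\<dots> = (\<Sum>m\<le>k. \<Sum>j\<le>m. scl M (of_nat j * c j * \<kappa> (m - j)) (?E (n - int m) (?F (k - m) v)))"
    by simp
  also have "\<dots> = (\<Sum>m\<le>k. scl M (of_nat m * \<kappa> m) (?E (n - int m) (?F (k - m) v)))"
    by (simp add: \<kappa> scale_sum_left)
  also have "(\<Sum>m\<le>k. scl M (\<kappa> m * of_nat (k - m)) (?E (n - int m) (?F (k - m) v))) + \<dots> =
     (\<Sum>m\<le>k. scl M (of_nat (k - m) + of_nat m) (scl M (\<kappa> m) (?E (n - int m) (?F (k - m) v))))"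
    by (simp add: scale_left_distrib distrib_left sum.distrib mult.commute del: of_nat_diff)
  also have "\<dots> = scl M (of_nat k) (\<Sum>m\<le>k. scl M (\<kappa> m) (?E (n - int m) (?F (k - m) v)))"
    by (simp add: scale_sum_right flip: of_nat_add)
  finally show "scl M (of_nat k) (\<Sum>m\<le>k. scl M (\<kappa> m) (?E (n - int m) (?F (k - m) v))) =
    (\<Sum>j\<le>k. scl M (of_nat j) (A j (\<Sum>m\<le>k - j. scl M (\<kappa> m) (?E (n - int m) (?F (k - j - m) v)))))"
    by simp
qed

end

section \<open>Creation and annihilation parts of a vertex operator\<close>

text \<open>The scalar \<open>[h\<^sub>i\<^sub>,\<^sub>n, h\<^sub>j\<^sub>,\<^sub>-\<^sub>n]\<close>.\<close>
definition bracket :: "params \<Rightarrow> nat \<Rightarrow> nat \<Rightarrow> int \<Rightarrow> complex" where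
  "bracket p i j n = (if i = j then of_int n
     else - of_int n * (q1 p powi n + q3 p powi n) / (1 + q2 p powi (- n)))"

text \<open>The coefficient at \<open>(w/z)\<^sup>n\<close> of the commutator of the annihilation part of \<open>X(z)\<close> with the
  creation part of \<open>Y(w)\<close>.\<close>
definition contraction :: "params \<Rightarrow> vexp \<Rightarrow> vexp \<Rightarrow> nat \<Rightarrow> complex" where
  "contraction p X Y n =
     (\<Sum>i\<in>{1, 2}. \<Sum>j\<in>{1, 2}. osc X i (int n) * osc Y j (- int n) * bracket p i j (int n))"

context heisenberg_module
begin

lemma lin_hmode [simp]: "i = 1 \<or> i = 2 \<Longrightarrow> lin (hmode M i n)"
  using linear_hmode[of i n] by auto

lemma hmode_commute:
  assumes "i \<in> {1, 2}" "j \<in> {1, 2}"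
  shows "hmode M i n (hmode M j m v) =
    hmode M j m (hmode M i n v) + scl M (if n + m = 0 then bracket p i j n else 0) v"
proof (cases "i = j")
  case True
  then show ?thesis using comm_h_same[of i n m v] assms
    unfolding commutator_def bracket_def by (simp add: algebra_simps)
next
  case False
  then show ?thesis using comm_h_diff[of i j n m v] assms
    unfolding commutator_def bracket_def by (auto simp add: algebra_simps)
qed

lemma hmode_commute_same_sign:
  assumes "i \<in> {1, 2}" "j \<in> {1, 2}" "n + m \<noteq> 0"
  shows "hmode M i n (hmode M j m v) = hmode M j m (hmode M i n v)"
  using hmode_commute[OF assms(1,2), of n m v] assms(3) by simp

lemma lin_creation: "lin (creation M X k)"
  by (rule linI) (auto simp: creation_def lin_facts[OF lin_hmode] scale_right_distrib mult_ac)

lemma lin_annihilation: "lin (annihilation M X k)"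
  by (rule linI) (auto simp: annihilation_def lin_facts[OF lin_hmode] scale_right_distrib mult_ac)

lemma creation_0: "creation M X 0 v = 0"
  and annihilation_0: "annihilation M X 0 v = 0"
  by (simp_all add: creation_def annihilation_def)

lemma creation_commute: "creation M X i (creation M Y j v) = creation M Y j (creation M X i v)"
  by (cases "i = 0 \<or> j = 0") (auto simp: creation_def lin_facts[OF lin_hmode] scale_right_distrib
      hmode_commute_same_sign[of 1 2 "- int i" "- int j"] hmode_commute_same_sign[of 2 1 "- int i" "- int j"]
      hmode_commute_same_sign[of 1 1 "- int i" "- int j"] hmode_commute_same_sign[of 2 2 "- int i" "- int j"] mult.commute simp del: One_nat_def)

lemma annihilation_commute: "annihilation M X i (annihilation M Y j v) = annihilation M Y j (annihilation M X i v)"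
  by (cases "i = 0 \<or> j = 0") (auto simp: annihilation_def lin_facts[OF lin_hmode] scale_right_distrib
      hmode_commute_same_sign[of 1 2 "int i" "int j"] hmode_commute_same_sign[of 2 1 "int i" "int j"]
      hmode_commute_same_sign[of 1 1 "int i" "int j"] hmode_commute_same_sign[of 2 2 "int i" "int j"] mult.commute simp del: One_nat_def)

lemma annihilation_creation:
  "annihilation M X i (creation M Y j v) =
     creation M Y j (annihilation M X i v) + scl M (if j = i then contraction p X Y i else 0) v"
proof (cases "i = 0 \<or> j = 0")
  case True
  then show ?thesis
    by (auto simp: creation_0 annihilation_0 lin_facts[OF lin_creation] lin_facts[OF lin_annihilation]
        contraction_def bracket_def)
next
  case False
  have pos: "(int i - int j = 0) = (j = i)" by auto
  from False show ?thesis
    by (simp add: creation_def annihilation_def lin_facts[OF lin_hmode] scale_right_distrib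
      hmode_commute[of 1 1 "int i" "- int j"] hmode_commute[of 2 1 "int i" "- int j"]
      hmode_commute[of 1 2 "int i" "- int j"] hmode_commute[of 2 2 "int i" "- int j"] pos contraction_def
       scale_left_distrib mult_ac del: One_nat_def)
qed

abbreviation cre :: "vexp \<Rightarrow> int \<Rightarrow> 'v \<Rightarrow> 'v" where
  "cre X \<equiv> opexp_int (creation M X)"

abbreviation ann :: "vexp \<Rightarrow> nat \<Rightarrow> 'v \<Rightarrow> 'v" where
  "ann X \<equiv> opexp M (annihilation M X)"

lemma lin_cre: "lin (cre X n)"
  by (rule lin_opexp_int) (rule lin_creation)

lemma lin_ann: "lin (ann X n)"
  by (rule lin_opexp) (rule lin_annihilation)

lemma opexp_commute_opexp:
  assumes "\<And>j. lin (Y j)" "\<And>j. lin (Z j)" "\<And>i j v. Y i (Z j v) = Z j (Y i v)"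
  shows "opexp M Y k (opexp M Z l v) = opexp M Z l (opexp M Y k v)"
  by (rule opexp_commute[where Y=Z, OF lin_opexp[OF assms(1)] assms(2)])
    (rule opexp_commute[where Y=Y, OF assms(2,1), symmetric], simp add: assms(3))

lemma cre_commute: "cre X i (cre Y j v) = cre Y j (cre X i v)"
  unfolding opexp_int_def
  using opexp_commute_opexp[where Y="creation M X" and Z="creation M Y", OF lin_creation lin_creation creation_commute]
  by (simp add: lin_facts[OF lin_opexp] lin_creation)

lemma ann_commute: "ann X i (ann Y j v) = ann Y j (ann X i v)"
  by (rule opexp_commute_opexp[OF lin_annihilation lin_annihilation annihilation_commute])

text \<open>Here \<open>\<Sum>\<^sub>k \<kappa> k (w/z)\<^sup>k\<close> is the contraction factor, the exponential of the contraction.\<close>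
lemma ann_cre:
  assumes "\<kappa> 0 = 1" and "\<And>k. of_nat k * \<kappa> k = (\<Sum>i\<le>k. of_nat i * contraction p X Y i * \<kappa> (k - i))"
  shows "ann X l (cre Y n v) = (\<Sum>m\<le>l. scl M (\<kappa> m) (cre Y (n - int m) (ann X (l - m) v)))"
  by (rule opexp_past_opexp[where c="contraction p X Y"])
    (fact lin_creation creation_0 creation_commute lin_annihilation annihilation_0 annihilation_commute
      annihilation_creation assms)+

lemma creation_nprod:
  "creation M (nprod (rescale l X) Y) j v = scl M (exp l ^ j) (creation M X j v) + creation M Y j v"
  by (simp add: creation_def nprod_def rescale_def scale_left_distrib scale_right_distrib algebra_simps flip: exp_of_nat_mult)

lemma annihilation_nprod:
  "annihilation M (nprod (rescale l X) Y) j v = scl M (exp (- l) ^ j) (annihilation M X j v) + annihilation M Y j v"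
  by (simp add: annihilation_def nprod_def rescale_def scale_left_distrib scale_right_distrib algebra_simps flip: exp_of_nat_mult)

lemma ann_nprod:
  "ann (nprod (rescale l X) Y) k v = (\<Sum>i\<le>k. scl M (exp (- l) ^ i) (ann X i (ann Y (k - i) v)))"
  by (rule opexp_fuse) (fact lin_annihilation annihilation_0 annihilation_commute annihilation_nprod)+

text \<open>The range of summation is any interval that contains the support \<open>{0..n}\<close>; the bounds arise from
  sums over both operators at once.\<close>
lemma cre_nprod:
  assumes "lo \<le> 0" and "n \<le> hi"
  shows "cre (nprod (rescale l X) Y) n v = (\<Sum>i\<in>{lo..hi}. scl M (exp l powi i) (cre X i (cre Y (n - i) v)))"
proof (cases "n < 0")
  case True
  then have "cre X i (cre Y (n - i) v) = 0" for i
    by (cases "i < 0") (simp_all add: opexp_int_def lin_facts[OF lin_opexp] lin_creation)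
  then show ?thesis using True by (simp add: opexp_int_def)
next
  case False
  have fuse: "opexp M (creation M (nprod (rescale l X) Y)) k v =
      (\<Sum>i\<le>k. scl M (exp l ^ i) (opexp M (creation M X) i (opexp M (creation M Y) (k - i) v)))" for k
    by (rule opexp_fuse) (fact lin_creation creation_0 creation_commute creation_nprod)+
  have "cre (nprod (rescale l X) Y) n v = (\<Sum>i\<le>nat n. scl M (exp l ^ i) (opexp M (creation M X) i (opexp M (creation M Y) (nat n - i) v)))"
    using False fuse by (simp add: opexp_int_def)
  also have "\<dots> = (\<Sum>i\<in>{0..n}. scl M (exp l powi i) (cre X i (cre Y (n - i) v)))"
    by (rule sum.reindex_bij_witness[of _ nat int])
      (use False in \<open>auto simp: opexp_int_def power_int_def nat_diff_distrib\<close>)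
  also have "\<dots> = (\<Sum>i\<in>{lo..hi}. scl M (exp l powi i) (cre X i (cre Y (n - i) v)))"
    by (rule sum.mono_neutral_left)
      (use assms in \<open>auto simp: opexp_int_def lin_facts[OF lin_opexp] lin_creation\<close>)
  finally show ?thesis .
qed

section \<open>Weight spaces of the zero modes\<close>

lemma Sum_any_scale:
  assumes "finite {x. f x \<noteq> 0}"
  shows "Sum_any (\<lambda>x. scl M c (f x)) = scl M c (Sum_any f)"
proof -
  have "Sum_any (\<lambda>x. scl M c (f x)) = (\<Sum>x\<in>{x. f x \<noteq> 0}. scl M c (f x))"
    by (rule Sum_any.expand_superset) (use assms in auto)
  also have "\<dots> = scl M c (Sum_any f)"
    by (simp add: Sum_any.expand_set scale_sum_right)
  finally show ?thesis .
qed

definition weight :: "int \<times> complex \<Rightarrow> 'v \<Rightarrow> bool" where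
  "weight x v \<longleftrightarrow> hmode M 1 0 v = scl M (of_int (fst x)) v \<and> a0 M v = scl M (snd x) v"

lemma weight_0: "weight x 0"
  by (simp add: weight_def lin_facts[OF lin_hmode] lin_facts[OF linear_a0])

lemma weight_scale: "weight x v \<Longrightarrow> weight x (scl M c v)"
  by (simp add: weight_def lin_facts[OF lin_hmode] lin_facts[OF linear_a0] mult.commute)

lemma weight_add: "weight x v \<Longrightarrow> weight x w \<Longrightarrow> weight x (v + w)"
  by (simp add: weight_def lin_facts[OF lin_hmode] lin_facts[OF linear_a0] scale_right_distrib)

lemma weight_sum: "(\<And>a. a \<in> A \<Longrightarrow> weight x (f a)) \<Longrightarrow> weight x (sum f A)"
  by (induction A rule: infinite_finite_induct) (auto simp: weight_0 weight_add)

text \<open>By induction on the number of weights: subtracting the eigenvalue of one summand from \<open>h\<^sub>1\<^sub>,\<^sub>0\<close> or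
  from \<open>a\<^sub>0\<close> kills that summand and multiplies each of the others by a scalar, and for each of the
  others one of the two scalars is nonzero.\<close>
lemma weight_spaces_independent:
  assumes "finite A" and "\<And>x. x \<in> A \<Longrightarrow> weight x (f x)" and "(\<Sum>x\<in>A. f x) = 0" and "x \<in> A"
  shows "f x = 0"
  using assms
proof (induction A arbitrary: f x rule: finite_induct)
  case (insert y A)
  have *: "hmode M 1 0 (f z) = scl M (of_int (fst z)) (f z)" "a0 M (f z) = scl M (snd z) (f z)"
    if "z \<in> insert y A" for z
    using insert.prems(1)[OF that] by (simp_all add: weight_def)
  have fy: "f y = - (\<Sum>x\<in>A. f x)"
    using insert.prems(2) insert.hyps by (simp add: eq_neg_iff_add_eq_0)
  have 1: "(\<Sum>z\<in>A. scl M (of_int (fst z) - of_int (fst y)) (f z)) = 0"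
  proof -
    have "0 = hmode M 1 0 (\<Sum>x\<in>insert y A. f x)"
      using insert.prems(2) by (simp add: lin_facts[OF lin_hmode])
    also have "\<dots> = (\<Sum>z\<in>insert y A. scl M (of_int (fst z)) (f z))"
      unfolding lin_sum[OF lin_hmode[OF disjI1[OF refl]]] by (rule sum.cong[OF refl *(1)])
    also have "\<dots> = scl M (of_int (fst y)) (f y) + (\<Sum>z\<in>A. scl M (of_int (fst z)) (f z))"
      using insert.hyps by simp
    finally show ?thesis
      unfolding fy by (simp add: scale_left_diff_distrib sum_subtractf scale_sum_right)
  qed
  have 2: "(\<Sum>z\<in>A. scl M (snd z - snd y) (f z)) = 0"
  proof -
    have "0 = a0 M (\<Sum>x\<in>insert y A. f x)"
      using insert.prems(2) by (simp add: lin_facts[OF linear_a0])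
    also have "\<dots> = (\<Sum>z\<in>insert y A. scl M (snd z) (f z))"
      unfolding lin_sum[OF linear_a0] by (rule sum.cong[OF refl *(2)])
    also have "\<dots> = scl M (snd y) (f y) + (\<Sum>z\<in>A. scl M (snd z) (f z))"
      using insert.hyps by simp
    finally show ?thesis
      unfolding fy by (simp add: scale_left_diff_distrib sum_subtractf scale_sum_right)
  qed
  have "f z = 0" if z: "z \<in> A" for z
  proof -
    have "scl M (of_int (fst z) - of_int (fst y)) (f z) = 0"
      by (rule insert.IH[OF _ 1 z]) (simp add: weight_scale insert.prems)
    moreover have "scl M (snd z - snd y) (f z) = 0"
      by (rule insert.IH[OF _ 2 z]) (simp add: weight_scale insert.prems)
    moreover have "z \<noteq> y" using z insert.hyps by auto
    ultimately show ?thesis by (auto simp: prod_eq_iff)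
  qed
  moreover from this have "f y = 0" using fy by simp
  ultimately show ?case using insert.prems(3) by blast
qed simp

definition weight_decomposition :: "'v \<Rightarrow> (int \<times> complex \<Rightarrow> 'v) \<Rightarrow> bool" where
  "weight_decomposition v f \<longleftrightarrow> finite {x. f x \<noteq> 0} \<and> (\<forall>x. weight x (f x)) \<and> Sum_any f = v"

lemma weight_decomposition_add:
  assumes "weight_decomposition v f" "weight_decomposition w g"
  shows "weight_decomposition (v + w) (\<lambda>x. f x + g x)"
proof -
  have "finite {x. f x + g x \<noteq> 0}"
    by (rule finite_subset[of _ "{x. f x \<noteq> 0} \<union> {x. g x \<noteq> 0}"])
      (use assms in \<open>auto simp: weight_decomposition_def\<close>)
  then show ?thesis
    using assms by (auto simp: weight_decomposition_def weight_add Sum_any.distrib)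
qed

lemma weight_decomposition_scale:
  assumes "weight_decomposition v f"
  shows "weight_decomposition (scl M c v) (\<lambda>x. scl M c (f x))"
proof -
  have "finite {x. scl M c (f x) \<noteq> 0}"
    by (rule finite_subset[of _ "{x. f x \<noteq> 0}"])
      (use assms in \<open>auto simp: weight_decomposition_def\<close>)
  then show ?thesis
    using assms by (auto simp: weight_decomposition_def weight_scale Sum_any_scale)
qed

lemma weight_decomposition_weight:
  "weight x v \<Longrightarrow> weight_decomposition v (\<lambda>y. if y = x then v else 0)"
  by (auto simp: weight_decomposition_def weight_0)

lemma weight_decomposition_unique:
  assumes "weight_decomposition v f" "weight_decomposition v g"
  shows "f = g"
proof
  fix x
  have "weight_decomposition (v - v) (\<lambda>x. f x - g x)"
    using weight_decomposition_add[OF assms(1) weight_decomposition_scale[OF assms(2), of "-1"]]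
    by simp
  then have d: "finite {x. f x - g x \<noteq> 0}" "\<And>x. weight x (f x - g x)" "Sum_any (\<lambda>x. f x - g x) = 0"
    by (auto simp: weight_decomposition_def)
  have "(\<Sum>y | f y - g y \<noteq> 0. f y - g y) = 0"
    using d(3) by (simp add: Sum_any.expand_set)
  from weight_spaces_independent[OF d(1) d(2) this]
  have "f x - g x = 0" by blast
  then show "f x = g x" by simp
qed

lemma weight_decomposition_exists: "\<exists>f. weight_decomposition v f"
proof (rule span_induct_alt[OF diagonalisable[of v]])
  show "\<exists>f. weight_decomposition 0 f"
    by (rule exI[of _ "\<lambda>_. 0"]) (simp add: weight_decomposition_def weight_0)
next
  fix c u v
  assume "u \<in> {u. \<exists>(k::int) \<mu>. hmode M 1 0 u = scl M (of_int k) u \<and> a0 M u = scl M \<mu> u}"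
  then obtain k \<mu> where "weight (k, \<mu>) u" by (auto simp: weight_def)
  then show "\<exists>f. weight_decomposition v f \<Longrightarrow> \<exists>f. weight_decomposition (scl M c u + v) f"
    using weight_decomposition_add weight_decomposition_scale weight_decomposition_weight by blast
qed

lemma weight_decomposition_wt: "weight_decomposition v (wt M v)"
proof -
  have "wt M v = (THE f. weight_decomposition v f)"
    by (simp add: wt_def weight_decomposition_def weight_def)
  then show ?thesis
    using theI'[of "weight_decomposition v"] weight_decomposition_exists weight_decomposition_unique by metis
qed

lemma wt_eqI: "weight_decomposition v f \<Longrightarrow> wt M v = f"
  by (rule weight_decomposition_unique[OF weight_decomposition_wt])

lemma wt_add: "wt M (v + w) x = wt M v x + wt M w x"
  by (simp add: wt_eqI[OF weight_decomposition_add[OF weight_decomposition_wt weight_decomposition_wt]])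

lemma wt_scale: "wt M (scl M c v) x = scl M c (wt M v x)"
  by (simp add: wt_eqI[OF weight_decomposition_scale[OF weight_decomposition_wt]])

lemma finite_wt: "finite {x. wt M v x \<noteq> 0}"
  using weight_decomposition_wt[of v] by (simp add: weight_decomposition_def)

text \<open>On the weight space of weight \<open>x\<close> the zero-mode factor of \<open>:exp X(z):\<close> is the scalar
  \<open>zscalar X x\<close> times \<open>z\<close> to the power \<open>zexponent X x\<close>.\<close>
definition zexponent :: "vexp \<Rightarrow> int \<times> complex \<Rightarrow> complex" where
  "zexponent X x = hlog X * of_int (fst x) + alog X * snd x"

definition zscalar :: "vexp \<Rightarrow> int \<times> complex \<Rightarrow> complex" where
  "zscalar X x = exp (hcst X * of_int (fst x) + acst X * snd x)"

lemma zero_modes_eq: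
  "zero_modes M X b v = Sum_any (\<lambda>x. if zexponent X x = b then scl M (zscalar X x) (wt M v x) else 0)"
  unfolding zero_modes_def zexponent_def zscalar_def
  by (rule Sum_any.cong) (simp add: case_prod_unfold)

lemma finite_zero_modes_term: "finite {x. (if zexponent X x = b then scl M (zscalar X x) (wt M v x) else 0) \<noteq> 0}"
  by (rule finite_subset[OF _ finite_wt[of v]]) auto

lemma lin_zero_modes: "lin (zero_modes M X b)"
proof (rule linI)
  show "zero_modes M X b (v + w) = zero_modes M X b v + zero_modes M X b w" for v w
    unfolding zero_modes_eq Sum_any.distrib[OF finite_zero_modes_term finite_zero_modes_term, symmetric]
    by (auto simp: wt_add scale_right_distrib intro!: Sum_any.cong)
  show "zero_modes M X b (scl M c v) = scl M c (zero_modes M X b v)" for c v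
    unfolding zero_modes_eq Sum_any_scale[OF finite_zero_modes_term, symmetric]
    by (auto simp: wt_scale mult.commute intro!: Sum_any.cong)
qed

lemma zero_modes_weight:
  assumes "weight x v"
  shows "zero_modes M X b v = (if zexponent X x = b then scl M (zscalar X x) v else 0)"
proof -
  have "zero_modes M X b v =
     Sum_any (\<lambda>y. if y = x then (if zexponent X x = b then scl M (zscalar X x) v else 0) else 0)"
    unfolding zero_modes_eq wt_eqI[OF weight_decomposition_weight[OF assms]]
    by (rule Sum_any.cong) auto
  then show ?thesis by simp
qed

lemma finite_zero_modes: "finite {b. zero_modes M X b v \<noteq> 0}"
proof (rule finite_subset)
  show "{b. zero_modes M X b v \<noteq> 0} \<subseteq> zexponent X ` {x. wt M v x \<noteq> 0}"
  proof
    fix b assume "b \<in> {b. zero_modes M X b v \<noteq> 0}"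
    then obtain x where "(if zexponent X x = b then scl M (zscalar X x) (wt M v x) else 0) \<noteq> 0"
      unfolding zero_modes_eq by (auto elim: Sum_any.not_neutral_obtains_not_neutral)
    then show "b \<in> zexponent X ` {x. wt M v x \<noteq> 0}" by (auto split: if_splits)
  qed
  show "finite (zexponent X ` {x. wt M v x \<noteq> 0})" by (simp add: finite_wt)
qed

section \<open>Local nilpotency of annihilation operators\<close>

text \<open>A filtration that measures how many more annihilation operators a vector can survive: after a total
  degree of \<open>d\<close> has been applied, any further degree above \<open>N - d\<close> gives zero. It makes the
  smoothness axiom, which concerns words in the modes, available for coefficients of exponentials.\<close>
definition killed :: "int \<Rightarrow> int \<Rightarrow> 'v set" where
  "killed N d = {v. \<forall>xs. (\<forall>(i, n)\<in>set xs. i \<in> {1, 2} \<and> n > 0) \<longrightarrow>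
     N < d + sum_list (map snd xs) \<longrightarrow> foldr (\<lambda>(i, n). hmode M i n) xs v = 0}"

lemma killed_exists: "\<exists>N. v \<in> killed N 0"
  using smooth[of v] unfolding killed_def by simp

lemma killed_eq_0: "v \<in> killed N d \<Longrightarrow> N < d \<Longrightarrow> v = 0"
  unfolding killed_def by (auto dest: spec[of _ "[]"])

lemma lin_hmodes: "\<forall>(i, n)\<in>set xs. i \<in> {1, 2} \<and> n > 0 \<Longrightarrow> lin (foldr (\<lambda>(i, n). hmode M i n) xs)"
proof (induction xs)
  case Nil
  show ?case by (rule linI) simp_all
next
  case (Cons x xs)
  obtain i n where x: "x = (i, n)" by (cases x)
  with Cons have "lin (hmode M i n)" "lin (foldr (\<lambda>(i, n). hmode M i n) xs)" by auto
  from lin_compose[OF this] show ?case by (simp add: x comp_def)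
qed

lemma killed_0: "0 \<in> killed N d"
  by (auto simp: killed_def lin_facts[OF lin_hmodes])

lemma killed_add: "v \<in> killed N d \<Longrightarrow> w \<in> killed N d \<Longrightarrow> v + w \<in> killed N d"
  by (auto simp: killed_def lin_facts[OF lin_hmodes])

lemma killed_scale: "v \<in> killed N d \<Longrightarrow> scl M c v \<in> killed N d"
  by (auto simp: killed_def lin_facts[OF lin_hmodes])

lemma killed_sum: "(\<And>a. a \<in> A \<Longrightarrow> f a \<in> killed N d) \<Longrightarrow> sum f A \<in> killed N d"
  by (induction A rule: infinite_finite_induct) (auto simp: killed_0 killed_add)

lemma killed_hmode:
  assumes "v \<in> killed N d" "i \<in> {1, 2}" "n > 0"
  shows "hmode M i n v \<in> killed N (d + n)"
  unfolding killed_def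
proof (intro CollectI allI impI)
  fix xs :: "(nat \<times> int) list"
  assume xs: "\<forall>(i, n)\<in>set xs. i \<in> {1, 2} \<and> n > 0" and "N < d + n + sum_list (map snd xs)"
  with assms have "foldr (\<lambda>(i, n). hmode M i n) (xs @ [(i, n)]) v = 0"
    unfolding killed_def by (intro mp[OF mp[OF spec[OF CollectD[OF assms(1)[unfolded killed_def]]]]]) auto
  then show "foldr (\<lambda>(i, n). hmode M i n) xs (hmode M i n v) = 0" by simp
qed

lemma killed_annihilation:
  assumes "v \<in> killed N d"
  shows "annihilation M X k v \<in> killed N (d + int k)"
  using assms by (auto simp: annihilation_def killed_0 intro!: killed_add killed_scale killed_hmode)

lemma killed_ann:
  assumes "v \<in> killed N d"
  shows "ann X k v \<in> killed N (d + int k)"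
proof -
  have "oppow (annihilation M X) n k v \<in> killed N (d + int k)" for n
  proof (induction n arbitrary: k)
    case (Suc n)
    have "annihilation M X j (oppow (annihilation M X) n (k - j) v) \<in> killed N (d + int k)" if "j \<le> k" for j
      using killed_annihilation[OF Suc.IH[of "k - j"], of X j] that by (simp add: of_nat_diff)
    then show ?case by (auto intro: killed_sum)
  qed (use assms in \<open>auto simp: killed_0\<close>)
  then show ?thesis by (auto simp: opexp_def intro!: killed_sum killed_scale)
qed

lemma ann_eventually_0: "\<exists>N. \<forall>l>N. ann X l v = 0"
proof -
  obtain N where "v \<in> killed N 0" using killed_exists by blast
  from killed_eq_0[OF killed_ann[OF this]] have "ann X l v = 0" if "l > nat N" for l
    using that by (metis add_0 zless_nat_conj zless_nat_eq_int_zless nat_less_iff not_less nat_le_iff linorder_not_le of_nat_less_iff)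
  then show ?thesis by blast
qed

section \<open>Vertex operators on weight vectors\<close>

definition vertex_term :: "vexp \<Rightarrow> complex \<Rightarrow> 'v \<Rightarrow> nat \<times> nat \<Rightarrow> 'v" where
  "vertex_term X a v = (\<lambda>(j, l). opexp M (creation M X) j (ann X l
       (expQ M (Q1 X) (Qa X) (zero_modes M X (a - of_nat j + of_nat l) v))))"

lemma vertex_eq: "vertex M X a v = Sum_any (vertex_term X a v)"
  by (simp add: vertex_def vertex_term_def)

lemma lin_vertex_term: "lin (\<lambda>v. vertex_term X a v jl)"
  unfolding vertex_term_def case_prod_unfold
  by (intro lin_compose[OF lin_opexp[OF lin_creation]] lin_compose[OF lin_ann] lin_compose[OF linear_expQ]
      lin_zero_modes)

lemma finite_vertex_term: "finite {jl. vertex_term X a v jl \<noteq> 0}"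
proof -
  define B where "B = {b. zero_modes M X b v \<noteq> 0}"
  have B: "finite B" unfolding B_def by (rule finite_zero_modes)
  have "\<forall>b. \<exists>N. \<forall>l>N. ann X l (expQ M (Q1 X) (Qa X) (zero_modes M X b v)) = 0"
    using ann_eventually_0 by blast
  then obtain N where N: "\<And>b l. N b < l \<Longrightarrow> ann X l (expQ M (Q1 X) (Qa X) (zero_modes M X b v)) = 0"
    by metis
  have "inj_on (\<lambda>(j, l). (a - of_nat j + of_nat l, l)) UNIV"
    by (auto simp: inj_on_def)
  moreover have "finite (SIGMA b:B. {..N b})"
    using B by auto
  ultimately have "finite ((\<lambda>(j, l). (a - of_nat j + of_nat l, l)) -` (SIGMA b:B. {..N b}) :: (nat \<times> nat) set)"
    by (rule finite_vimageI[rotated])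
  \<comment> \<open>The pair consisting of the zero-mode exponent and \<open>l\<close> recovers \<open>j\<close>.\<close>
  moreover have "{jl. vertex_term X a v jl \<noteq> 0} \<subseteq> (\<lambda>(j, l). (a - of_nat j + of_nat l, l)) -` (SIGMA b:B. {..N b})"
  proof clarify
    fix j l assume nz: "vertex_term X a v (j, l) \<noteq> 0"
    then have "ann X l (expQ M (Q1 X) (Qa X) (zero_modes M X (a - of_nat j + of_nat l) v)) \<noteq> 0"
      by (auto simp: vertex_term_def lin_facts[OF lin_opexp[OF lin_creation]])
    moreover from this have "zero_modes M X (a - of_nat j + of_nat l) v \<noteq> 0"
      by (auto simp: lin_facts[OF lin_ann] lin_facts[OF linear_expQ])
    ultimately show "(j, l) \<in> (\<lambda>(j, l). (a - of_nat j + of_nat l, l)) -` (SIGMA b:B. {..N b})"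
      using N[of "a - of_nat j + of_nat l" l] by (auto simp: B_def not_less[symmetric])
  qed
  ultimately show ?thesis by (rule finite_subset[rotated])
qed

text \<open>The defining sum of a coefficient is linear because it has finite support on every vector: smoothness
  bounds the annihilation degree \<open>l\<close>, and the finitely many weights of the vector then leave finitely many
  creation degrees \<open>j\<close>.\<close>
lemma lin_vertex: "lin (vertex M X a)"
proof (rule linI)
  show "vertex M X a (v + w) = vertex M X a v + vertex M X a w" for v w
    unfolding vertex_eq Sum_any.distrib[OF finite_vertex_term finite_vertex_term, symmetric]
    by (rule Sum_any.cong) (rule lin_add[OF lin_vertex_term])
  show "vertex M X a (scl M c v) = scl M c (vertex M X a v)" for c v
    unfolding vertex_eq Sum_any_scale[OF finite_vertex_term, symmetric]
    by (rule Sum_any.cong) (rule lin_scale[OF lin_vertex_term])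
qed

text \<open>Only the modes of the two bosons matter, whereas \<open>osc\<close> carries values for every index.\<close>
lemma vertex_cong:
  assumes "\<And>i n. i \<in> {1, 2} \<Longrightarrow> osc X i n = osc Y i n"
    and "Q1 X = Q1 Y" "Qa X = Qa Y" "hlog X = hlog Y" "hcst X = hcst Y" "alog X = alog Y" "acst X = acst Y"
  shows "vertex M X = vertex M Y"
proof -
  have "creation M X = creation M Y" "annihilation M X = annihilation M Y"
    by (intro ext, simp add: creation_def annihilation_def assms(1))+
  moreover have "zero_modes M X = zero_modes M Y"
    by (intro ext) (simp only: zero_modes_def assms(2-))
  ultimately show ?thesis
    by (intro ext) (simp only: vertex_def assms(2-))
qed

lemma opexp_rescale:
  assumes Y: "\<And>j. lin (Y j)" and Z: "\<And>j v. Z j v = scl M (c ^ j) (Y j v)"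
  shows "opexp M Z k v = scl M (c ^ k) (opexp M Y k v)"
proof -
  have Zfun: "oppow Z N k v = scl M (c ^ k) (oppow Y N k v)" for N k
  proof (induction N arbitrary: k)
    case (Suc N)
    show ?case
      by (simp add: Suc.IH) (simp add: Z lin_facts[OF Y] scale_sum_right flip: power_add)
  qed simp
  show ?thesis
    by (simp add: opexp_def Zfun scale_sum_right mult.commute)
qed

text \<open>The substitution \<open>z \<mapsto> e\<^sup>l z\<close> in the exponent multiplies the coefficient at \<open>z\<^sup>a\<close> by \<open>e\<^sup>a\<^sup>l\<close>. For
  non-integral \<open>a\<close> this uses the chosen logarithm \<open>l\<close> rather than \<open>e\<^sup>l\<close>.\<close>
lemma vertex_rescale: "vertex M (rescale l X) a v = scl M (exp (a * l)) (vertex M X a v)"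
proof -
  have c: "opexp M (creation M (rescale l X)) k v = scl M (exp l ^ k) (opexp M (creation M X) k v)" for k v
    by (rule opexp_rescale[OF lin_creation])
      (simp add: creation_def rescale_def scale_right_distrib algebra_simps flip: exp_of_nat_mult)
  have a: "ann (rescale l X) k v = scl M (exp (- l) ^ k) (ann X k v)" for k v
    by (rule opexp_rescale[OF lin_annihilation])
      (simp add: annihilation_def rescale_def scale_right_distrib algebra_simps flip: exp_of_nat_mult)
  have z: "zero_modes M (rescale l X) b v = scl M (exp (b * l)) (zero_modes M X b v)" for b
    unfolding zero_modes_eq Sum_any_scale[OF finite_zero_modes_term, symmetric]
    by (rule Sum_any.cong) (auto simp: zexponent_def zscalar_def rescale_def algebra_simps simp flip: exp_add)
  have q: "Q1 (rescale l X) = Q1 X" "Qa (rescale l X) = Qa X"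
    by (simp_all add: rescale_def)
  have "vertex_term (rescale l X) a v jl = scl M (exp (a * l)) (vertex_term X a v jl)" for jl
  proof (cases jl)
    case (Pair j k)
    have "exp ((a - of_nat j + of_nat k) * l) * (exp (- l) ^ k * exp l ^ j) = exp (a * l)"
      by (simp add: algebra_simps flip: exp_of_nat_mult exp_add)
    then show ?thesis
      unfolding Pair vertex_term_def
      by (simp only: prod.case c a z q lin_scale[OF lin_opexp[OF lin_creation]] lin_scale[OF lin_ann]
          lin_scale[OF linear_expQ] scale_scale mult.assoc)
  qed
  then show ?thesis
    unfolding vertex_eq Sum_any_scale[OF finite_vertex_term, symmetric] by simp
qed

lemma expQ_hmode: "i \<in> {1, 2} \<Longrightarrow> n \<noteq> 0 \<Longrightarrow> expQ M k t (hmode M i n v) = hmode M i n (expQ M k t v)"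
  using comm_h_expQ[of i n k t v] by (simp add: commutator_def)

lemma expQ_ann: "expQ M k t (ann X l v) = ann X l (expQ M k t v)"
  by (rule opexp_commute[OF linear_expQ lin_annihilation])
    (auto simp: annihilation_def lin_facts[OF linear_expQ] expQ_hmode expQ_hmode[of 1, simplified])

lemma expQ_cre: "expQ M k t (cre X n v) = cre X n (expQ M k t v)"
  unfolding opexp_int_def
  by (auto simp: lin_facts[OF linear_expQ] creation_def expQ_hmode expQ_hmode[of 1, simplified]
      intro!: opexp_commute[OF linear_expQ lin_creation])

lemma weight_expQ:
  "weight x v \<Longrightarrow> weight (fst x + k, snd x + t * beta p / 2) (expQ M k t v)"
  using comm_h_expQ[of 1 0 k t v] comm_a0_expQ[of k t v]
  by (simp add: weight_def commutator_def chi_def lin_facts[OF linear_expQ] scale_left_distrib diff_eq_eq add.commute)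

lemma weight_hmode: "weight x v \<Longrightarrow> i \<in> {1, 2} \<Longrightarrow> n \<noteq> 0 \<Longrightarrow> weight x (hmode M i n v)"
  using hmode_commute_same_sign[of i 1 n 0 v] comm_h_a0[of i n v]
  by (auto simp: weight_def commutator_def lin_facts[OF lin_hmode])

lemma weight_oppow:
  assumes "\<And>j v. weight x v \<Longrightarrow> weight x (Y j v)" "weight x v"
  shows "weight x (oppow Y N k v)"
  using assms(2) by (induction N arbitrary: k) (auto simp: weight_0 intro!: weight_sum assms(1))

lemma weight_opexp:
  assumes "\<And>j v. weight x v \<Longrightarrow> weight x (Y j v)" "weight x v"
  shows "weight x (opexp M Y k v)"
  unfolding opexp_def by (intro weight_sum weight_scale weight_oppow[OF assms]) auto

lemma weight_ann: "weight x v \<Longrightarrow> weight x (ann X l v)"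
  by (rule weight_opexp)
    (auto simp: annihilation_def weight_0 intro!: weight_add weight_scale weight_hmode)

lemma weight_cre: "weight x v \<Longrightarrow> weight x (cre X n v)"
  unfolding opexp_int_def
  by (auto simp: weight_0 creation_def intro!: weight_opexp weight_add weight_scale weight_hmode)

text \<open>The weight fixes the power of \<open>z\<close> that the zero modes contribute, so the annihilation degree \<open>l\<close>
  determines the creation degree \<open>n + l\<close>. Any \<open>N\<close> beyond the surviving annihilation degrees serves
  as the cutoff.\<close>
lemma vertex_weight:
  assumes v: "weight x v" and N: "\<And>l. N < l \<Longrightarrow> ann X l (expQ M (Q1 X) (Qa X) v) = 0"
  shows "vertex M X (zexponent X x + of_int n) v =
    scl M (zscalar X x) (\<Sum>l\<le>N. cre X (n + int l) (ann X l (expQ M (Q1 X) (Qa X) v)))"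
proof -
  let ?u = "expQ M (Q1 X) (Qa X) v"
  let ?a = "zexponent X x + of_int n"
  have eq: "(zexponent X x = ?a - of_nat j + of_nat l) = (int j = n + int l)" for j l
  proof -
    have "(zexponent X x = ?a - of_nat j + of_nat l) = (of_int (int j) = (of_int (n + int l) :: complex))"
      by (auto simp: algebra_simps)
    then show ?thesis by (simp only: of_int_eq_iff)
  qed
  have t: "vertex_term X ?a v (j, l) = (if int j = n + int l
      then scl M (zscalar X x) (opexp M (creation M X) j (ann X l ?u)) else 0)" for j l
    unfolding vertex_term_def
    by (simp add: zero_modes_weight[OF v] eq lin_facts[OF linear_expQ] lin_facts[OF lin_ann]
        lin_facts[OF lin_opexp[OF lin_creation]])
  have "vertex M X ?a v = sum (vertex_term X ?a v) ((\<lambda>l. (nat (n + int l), l)) ` {..N})"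
    unfolding vertex_eq
  proof (rule Sum_any.expand_superset)
    show "{jl. vertex_term X ?a v jl \<noteq> 0} \<subseteq> (\<lambda>l. (nat (n + int l), l)) ` {..N}"
    proof clarify
      fix j l assume "vertex_term X ?a v (j, l) \<noteq> 0"
      then have "int j = n + int l" "ann X l ?u \<noteq> 0"
        unfolding t by (auto simp: lin_facts[OF lin_opexp[OF lin_creation]] split: if_splits)
      then have "j = nat (n + int l)" "l \<le> N" using N[of l] by (auto simp: not_less[symmetric])
      then show "(j, l) \<in> (\<lambda>l. (nat (n + int l), l)) ` {..N}" by blast
    qed
  qed simp
  also have "\<dots> = (\<Sum>l\<le>N. vertex_term X ?a v (nat (n + int l), l))"
    by (rule sum.reindex_cong[of "\<lambda>l. (nat (n + int l), l)"]) (auto simp: inj_on_def)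
  also have "\<dots> = (\<Sum>l\<le>N. scl M (zscalar X x) (cre X (n + int l) (ann X l ?u)))"
    by (rule sum.cong) (auto simp: t opexp_int_def)
  finally show ?thesis by (simp add: scale_sum_right)
qed

lemma vertex_weight_eq_0:
  assumes v: "weight x v" and a: "a - zexponent X x \<notin> \<int>"
  shows "vertex M X a v = 0"
proof -
  have "vertex_term X a v (j, l) = 0" for j l
  proof -
    have "zexponent X x \<noteq> a - of_nat j + of_nat l"
    proof
      assume "zexponent X x = a - of_nat j + of_nat l"
      then have "a - zexponent X x = of_int (int j - int l)" by (simp add: algebra_simps)
      with a show False by (metis Ints_of_int)
    qed
    then show ?thesis
      by (simp add: vertex_term_def zero_modes_weight[OF v] lin_facts[OF linear_expQ] lin_facts[OF lin_ann]
          lin_facts[OF lin_opexp[OF lin_creation]])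
  qed
  then have "vertex_term X a v = (\<lambda>_. 0)" by auto
  then show ?thesis by (simp add: vertex_eq)
qed

section \<open>Products of two vertex operators\<close>

text \<open>A single cutoff for the two operators of a product and for the operator that they fuse into.\<close>
lemma killed_pair_exists:
  "\<exists>N. \<forall>i j. N < i + j \<longrightarrow> ann X i (ann Y j u) = 0 \<and> ann (nprod (rescale l X) Y) (i + j) u = 0"
proof -
  obtain N where N: "u \<in> killed N 0" using killed_exists by blast
  have "ann X i (ann Y j u) = 0 \<and> ann (nprod (rescale l X) Y) (i + j) u = 0" if "nat N < i + j" for i j
  proof
    from that have "N < 0 + int j + int i" "N < 0 + int (i + j)" by auto
    with killed_ann[OF killed_ann[OF N, of Y j], of X i] killed_ann[OF N, of "nprod (rescale l X) Y" "i + j"]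
    show "ann X i (ann Y j u) = 0" "ann (nprod (rescale l X) Y) (i + j) u = 0"
      using killed_eq_0 by blast+
  qed
  then show ?thesis by blast
qed

text \<open>The coefficient at \<open>z\<^sup>m w\<^sup>n\<close> of the oscillator part of \<open>:exp X(z) exp Y(w):\<close> applied to \<open>u\<close>, with
  annihilation degrees cut off at \<open>N\<close>.\<close>
definition normally_ordered :: "vexp \<Rightarrow> vexp \<Rightarrow> nat \<Rightarrow> int \<Rightarrow> int \<Rightarrow> 'v \<Rightarrow> 'v" where
  "normally_ordered X Y N m n u =
     (\<Sum>i\<le>N. \<Sum>j\<le>N. cre X (m + int i) (cre Y (n + int j) (ann X i (ann Y j u))))"

lemma normally_ordered_commute: "normally_ordered Y X N n m u = normally_ordered X Y N m n u"
  unfolding normally_ordered_def by (subst sum.swap) (simp add: cre_commute[of X] ann_commute[of X])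

lemma cre_neg: "n < 0 \<Longrightarrow> cre X n v = 0"
  by (simp add: opexp_int_def)

text \<open>Wick's theorem on a weight vector. The zero modes of \<open>X\<close> meet the charge of \<open>Y\<close> and contribute the
  scalar exponential and \<open>z\<^sup>e\<close>, the oscillators contribute \<open>\<Sum>\<^sub>k \<kappa> k (w/z)\<^sup>k\<close>. The sum stops at \<open>K\<close>
  because beyond it the creation degree of \<open>Y\<close> would be negative.\<close>
lemma vertex_vertex:
  assumes v: "weight x v" and u: "u = expQ M (Q1 X + Q1 Y) (Qa X + Qa Y) v"
    and N: "\<And>i j. N < i + j \<Longrightarrow> ann X i (ann Y j u) = 0"
    and \<kappa>: "\<kappa> 0 = 1" "\<And>k. of_nat k * \<kappa> k = (\<Sum>i\<le>k. of_nat i * contraction p X Y i * \<kappa> (k - i))"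
    and e: "hlog X * of_int (Q1 Y) + alog X * (Qa Y * beta p / 2) = of_int e"
    and K: "n + int N \<le> int K"
  shows "vertex M X (zexponent X x + of_int m) (vertex M Y (zexponent Y x + of_int n) v) =
    scl M (zscalar X x * zscalar Y x * exp (hcst X * of_int (Q1 Y) + acst X * (Qa Y * beta p / 2)))
     (\<Sum>k\<le>K. scl M (\<kappa> k) (normally_ordered X Y N (m - e + int k) (n - int k) u))"
proof -
  define v1 where "v1 = vertex M Y (zexponent Y x + of_int n) v"
  let ?uY = "expQ M (Q1 Y) (Qa Y) v"
  have u_eq: "expQ M (Q1 X) (Qa X) ?uY = u"
    by (simp add: u expQ_add)
  have uY: "?uY = expQ M (- Q1 X) (- Qa X) u"
    unfolding u expQ_add[symmetric] by (simp add: algebra_simps)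
  \<comment> \<open>The charge operators are invertible and commute with the oscillators, so the cutoff for \<open>u\<close> serves for \<open>Y\<close> alone.\<close>
  have annY: "ann Y j ?uY = 0" if "N < j" for j
    using N[of 0 j] that unfolding uY by (simp add: opexp_0 lin_facts[OF linear_expQ] flip: expQ_ann)
  have v1: "v1 = scl M (zscalar Y x) (\<Sum>j\<le>N. cre Y (n + int j) (ann Y j ?uY))"
    unfolding v1_def by (rule vertex_weight[OF v annY])
  define y where "y = (fst x + Q1 Y, snd x + Qa Y * beta p / 2)"
  have "weight y v1"
    unfolding v1 y_def by (intro weight_scale weight_sum weight_cre weight_ann weight_expQ v)
  have expo: "zexponent X x + of_int m = zexponent X y + of_int (m - e)"
    using e by (simp add: zexponent_def y_def algebra_simps)
  have scal: "zscalar X y = zscalar X x * exp (hcst X * of_int (Q1 Y) + acst X * (Qa Y * beta p / 2))"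
    by (simp add: zscalar_def y_def algebra_simps flip: exp_add)
  define u1 where "u1 = expQ M (Q1 X) (Qa X) v1"
  have u1: "u1 = scl M (zscalar Y x) (\<Sum>j\<le>N. cre Y (n + int j) (ann Y j u))"
    by (simp add: u1_def v1 lin_facts[OF linear_expQ] expQ_cre expQ_ann u_eq)
  obtain N1 where N1: "\<And>l. N1 < l \<Longrightarrow> ann X l u1 = 0"
    using ann_eventually_0 by blast
  \<comment> \<open>From \<open>N + K\<close> on the triangle of pairs with \<open>k + i \<le> L\<close> contains the rectangle \<open>k \<le> K\<close>, \<open>i \<le> N\<close>.\<close>
  define L where "L = max N1 (N + K)"
  \<comment> \<open>\<open>T k i\<close> collects the terms of contraction degree \<open>k\<close> and remaining annihilation degree \<open>i\<close> of \<open>X\<close>.\<close>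
  define T where "T k i = scl M (\<kappa> k) (\<Sum>j\<le>N. cre X (m - e + int k + int i) (cre Y (n - int k + int j) (ann X i (ann Y j u))))" for k i
  have T0: "T k i = 0" if "K < k \<or> N < i" for k i
  proof -
    have "cre X (m - e + int k + int i) (cre Y (n - int k + int j) (ann X i (ann Y j u))) = 0" if "j \<le> N" for j
    proof (cases "N < i")
      case True
      then show ?thesis by (simp add: N lin_facts[OF lin_cre])
    next
      case False
      then have "n - int k + int j < 0" using that K \<open>K < k \<or> N < i\<close> by auto
      then show ?thesis by (simp add: cre_neg lin_facts[OF lin_cre])
    qed
    then show ?thesis by (simp add: T_def)
  qed
  have ann_u1: "cre X (m - e + int l) (ann X l u1) = scl M (zscalar Y x) (\<Sum>k\<le>l. T k (l - k))" for l
  proof -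
    have "cre X (m - e + int l) (ann X l u1) = scl M (zscalar Y x)
       (\<Sum>j\<le>N. \<Sum>k\<le>l. scl M (\<kappa> k) (cre X (m - e + int l) (cre Y (n + int j - int k) (ann X (l - k) (ann Y j u)))))"
      unfolding u1 by (simp add: lin_facts[OF lin_ann] lin_facts[OF lin_cre] ann_cre[OF \<kappa>])
    also have "\<dots> = scl M (zscalar Y x) (\<Sum>k\<le>l. T k (l - k))"
      unfolding T_def by (subst sum.swap) (simp add: scale_sum_right of_nat_diff algebra_simps)
    finally show ?thesis .
  qed
  have "vertex M X (zexponent X x + of_int m) v1 = scl M (zscalar X y) (\<Sum>l\<le>L. cre X (m - e + int l) (ann X l u1))"
    unfolding expo u1_def
    by (rule vertex_weight[OF \<open>weight y v1\<close>]) (use N1 in \<open>auto simp: L_def u1_def\<close>)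
  also have "(\<Sum>l\<le>L. cre X (m - e + int l) (ann X l u1)) = scl M (zscalar Y x) (\<Sum>l\<le>L. \<Sum>k\<le>l. T k (l - k))"
    unfolding ann_u1 by (rule scale_sum_right[symmetric])
  also have "(\<Sum>l\<le>L. \<Sum>k\<le>l. T k (l - k)) = (\<Sum>k\<le>K. \<Sum>i\<le>N. T k i)"
    by (rule sum_diagonals_rectangle[OF _ T0]) (auto simp: L_def)
  also have "\<dots> = (\<Sum>k\<le>K. scl M (\<kappa> k) (normally_ordered X Y N (m - e + int k) (n - int k) u))"
    by (simp add: T_def normally_ordered_def scale_sum_right)
  finally show ?thesis
    by (simp add: scal v1_def mult_ac)
qed

lemma vertex_vertex_eq_0:
  assumes v: "weight x v"
    and e: "hlog X * of_int (Q1 Y) + alog X * (Qa Y * beta p / 2) = of_int e"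
    and ab: "a - zexponent X x \<notin> \<int> \<or> b - zexponent Y x \<notin> \<int>"
  shows "vertex M X a (vertex M Y b v) = 0"
proof (cases "b - zexponent Y x \<in> \<int>")
  case False
  then show ?thesis by (simp add: vertex_weight_eq_0[OF v] lin_facts[OF lin_vertex])
next
  case True
  then obtain n where "b - zexponent Y x = of_int n" by (auto elim: Ints_cases)
  then have b: "b = zexponent Y x + of_int n" by (simp add: algebra_simps)
  obtain N where N: "\<And>l. N < l \<Longrightarrow> ann Y l (expQ M (Q1 Y) (Qa Y) v) = 0"
    using ann_eventually_0 by blast
  have vertex_b: "vertex M Y b v = scl M (zscalar Y x) (\<Sum>l\<le>N. cre Y (n + int l) (ann Y l (expQ M (Q1 Y) (Qa Y) v)))"
    unfolding b by (rule vertex_weight[OF v N])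
  have "weight (fst x + Q1 Y, snd x + Qa Y * beta p / 2) (vertex M Y b v)"
    unfolding vertex_b by (intro weight_scale weight_sum weight_cre weight_ann weight_expQ v)
  moreover have "a - zexponent X (fst x + Q1 Y, snd x + Qa Y * beta p / 2) = a - zexponent X x - of_int e"
    by (simp add: zexponent_def e[symmetric] algebra_simps)
  then have "a - zexponent X (fst x + Q1 Y, snd x + Qa Y * beta p / 2) \<notin> \<int>"
    using ab True by (metis Ints_add Ints_of_int diff_add_cancel)
  ultimately show ?thesis by (rule vertex_weight_eq_0)
qed

text \<open>Setting \<open>z = e\<^sup>l w\<close> in \<open>:exp X(z) exp Y(w):\<close>: the coefficients with a fixed total degree, weighted by
  powers of \<open>e\<^sup>l\<close>, add up to a coefficient of the single exponential \<open>:exp (X(e\<^sup>l w) + Y(w)):\<close>.\<close>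
lemma normally_ordered_fuse:
  assumes N: "\<And>i j. N < i + j \<Longrightarrow> ann X i (ann Y j u) = 0"
    and lo: "lo \<le> - m - int N" and hi: "n + int N \<le> hi"
  shows "(\<Sum>k\<in>{lo..hi}. scl M (exp l powi k) (normally_ordered X Y N (m + k) (n - k) u)) =
    scl M (exp l powi (- m)) (\<Sum>i\<le>N. cre (nprod (rescale l X) Y) (m + n + int i) (ann (nprod (rescale l X) Y) i u))"
proof -
  let ?Z = "nprod (rescale l X) Y"
  let ?r = "exp l"
  have pw: "?r powi k = ?r powi (- m) * (exp (- l) ^ i * ?r powi (m + k + int i))" for k i
  proof -
    have "exp (- l) ^ i = ?r powi (- int i)"
      by (simp add: power_int_minus exp_minus power_inverse)
    then show ?thesis by (simp flip: power_int_add)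
  qed
  have inner: "(\<Sum>k\<in>{lo..hi}. scl M (?r powi k) (cre X (m + k + int i) (cre Y (n - k + int j) w))) =
      scl M (?r powi (- m)) (scl M (exp (- l) ^ i) (cre ?Z (m + n + int (i + j)) w))"
    if ij: "i \<le> N" "j \<le> N" for i j w
  proof -
    have "(\<Sum>k\<in>{lo..hi}. scl M (?r powi k) (cre X (m + k + int i) (cre Y (n - k + int j) w))) =
       (\<Sum>k\<in>{lo..hi}. scl M (?r powi (- m)) (scl M (exp (- l) ^ i) (scl M (?r powi (m + k + int i))
          (cre X (m + k + int i) (cre Y (m + n + int (i + j) - (m + k + int i)) w)))))"
    proof (rule sum.cong[OF refl])
      fix k
      have "n - k + int j = m + n + int (i + j) - (m + k + int i)" by simp
      then show "scl M (?r powi k) (cre X (m + k + int i) (cre Y (n - k + int j) w)) =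
          scl M (?r powi (- m)) (scl M (exp (- l) ^ i) (scl M (?r powi (m + k + int i))
          (cre X (m + k + int i) (cre Y (m + n + int (i + j) - (m + k + int i)) w))))"
        using pw[of k i] by (simp only: scale_scale mult.assoc)
    qed
    also have "\<dots> = scl M (?r powi (- m)) (scl M (exp (- l) ^ i)
        (\<Sum>k\<in>{lo..hi}. scl M (?r powi (m + k + int i)) (cre X (m + k + int i) (cre Y (m + n + int (i + j) - (m + k + int i)) w))))"
      by (simp only: scale_sum_right)
    also have "(\<Sum>k\<in>{lo..hi}. scl M (?r powi (m + k + int i)) (cre X (m + k + int i) (cre Y (m + n + int (i + j) - (m + k + int i)) w)))
       = (\<Sum>k\<in>{m + lo + int i..m + hi + int i}. scl M (?r powi k) (cre X k (cre Y (m + n + int (i + j) - k) w)))"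
      by (rule sum.reindex_bij_witness[of _ "\<lambda>k. k - m - int i" "\<lambda>k. m + k + int i"]) auto
    also have "\<dots> = cre ?Z (m + n + int (i + j)) w"
      by (rule cre_nprod[symmetric]) (use lo hi ij in auto)
    finally show ?thesis .
  qed
  define f where "f i j = scl M (exp (- l) ^ i) (cre ?Z (m + n + int (i + j)) (ann X i (ann Y j u)))" for i j
  have f0: "f i j = 0" if "N < i + j" for i j
    using N[OF that] by (simp add: f_def lin_facts[OF lin_cre])
  have "(\<Sum>k\<in>{lo..hi}. scl M (?r powi k) (normally_ordered X Y N (m + k) (n - k) u)) =
     (\<Sum>i\<le>N. \<Sum>j\<le>N. \<Sum>k\<in>{lo..hi}. scl M (?r powi k) (cre X (m + k + int i) (cre Y (n - k + int j) (ann X i (ann Y j u)))))"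
    unfolding normally_ordered_def scale_sum_right
    by (subst sum.swap, rule sum.cong[OF refl], subst sum.swap, rule refl)
  also have "\<dots> = scl M (?r powi (- m)) (\<Sum>i\<le>N. \<Sum>j\<le>N. f i j)"
    by (simp add: inner f_def scale_sum_right)
  also have "(\<Sum>i\<le>N. \<Sum>j\<le>N. f i j) = (\<Sum>i\<le>N. \<Sum>j\<le>N - i. f i j)"
    by (intro sum.cong sum.mono_neutral_right) (auto intro: f0)
  also have "\<dots> = (\<Sum>i\<le>N. \<Sum>j\<le>i. f j (i - j))"
    by (rule sum_diagonals[symmetric])
  also have "\<dots> = (\<Sum>i\<le>N. cre ?Z (m + n + int i) (ann ?Z i u))"
    by (simp add: f_def ann_nprod lin_facts[OF lin_cre])
  finally show ?thesis .
qed

end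

section \<open>Anticommutators with linear and geometric contractions\<close>

text \<open>\<open>exp (\<Sum>\<^sub>i (r t)\<^sup>i / i) = 1 / (1 - r t)\<close>.\<close>
lemma geometric_recursion:
  fixes r :: complex
  assumes c: "\<And>i. i > 0 \<Longrightarrow> c i = r ^ i / of_nat i"
  shows "of_nat k * r ^ k = (\<Sum>i\<le>k. of_nat i * c i * r ^ (k - i))"
proof -
  have "(\<Sum>i\<le>k. of_nat i * c i * r ^ (k - i)) = (\<Sum>i\<le>k. if i = 0 then 0 else r ^ k)"
    by (rule sum.cong) (auto simp: c simp flip: power_add)
  also have "\<dots> = (\<Sum>i\<in>{1..k}. r ^ k)"
    by (rule sum.mono_neutral_cong_right) auto
  finally show ?thesis by simp
qed

definition binomial_coeffs :: "complex \<Rightarrow> nat \<Rightarrow> complex" where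
  "binomial_coeffs r k = (if k = 0 then 1 else if k = 1 then - r else 0)"

text \<open>\<open>exp (- \<Sum>\<^sub>i (r t)\<^sup>i / i) = 1 - r t\<close>.\<close>
lemma binomial_recursion:
  fixes r :: complex
  assumes c: "\<And>i. i > 0 \<Longrightarrow> c i = - (r ^ i / of_nat i)"
  shows "of_nat k * binomial_coeffs r k = (\<Sum>i\<le>k. of_nat i * c i * binomial_coeffs r (k - i))"
proof (cases "k = 0")
  case False
  then obtain n where k: "k = Suc n" by (cases k) auto
  have "(\<Sum>i\<le>k. of_nat i * c i * binomial_coeffs r (k - i)) =
      (\<Sum>i\<in>{n, Suc n}. of_nat i * c i * binomial_coeffs r (k - i))"
    by (rule sum.mono_neutral_right) (auto simp: k binomial_coeffs_def)
  also have "\<dots> = of_nat n * c n * (- r) + of_nat k * c k"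
    by (simp add: k binomial_coeffs_def)
  also have "of_nat k * c k = - (r ^ k)" using False by (simp add: c)
  also have "of_nat n * c n * (- r) = (if n = 0 then 0 else r ^ k)"
    by (simp add: c k)
  finally show ?thesis by (auto simp: k binomial_coeffs_def)
qed simp

context heisenberg_module
begin

lemma lin_eqI:
  assumes f: "lin f" and g: "lin g" and eq: "\<And>x v. weight x v \<Longrightarrow> f v = g v"
  shows "f = g"
proof
  fix v
  show "f v = g v"
  proof (rule span_induct_alt[OF diagonalisable[of v]])
    fix c u v
    assume "u \<in> {u. \<exists>(k::int) \<mu>. hmode M 1 0 u = scl M (of_int k) u \<and> a0 M u = scl M \<mu> u}"
    then obtain k \<mu> where "weight (k, \<mu>) u" by (auto simp: weight_def)
    then have "f u = g u" by (rule eq)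
    then show "f v = g v \<Longrightarrow> f (scl M c u + v) = g (scl M c u + v)"
      by (simp add: lin_facts[OF f] lin_facts[OF g])
  qed (simp add: lin_facts[OF f] lin_facts[OF g])
qed

lemma lin_plus: "lin f \<Longrightarrow> lin g \<Longrightarrow> lin (\<lambda>v. f v + g v)"
  by (rule linI) (simp_all add: lin_facts scale_right_distrib)

lemma lin_anticommutator: "lin (anticommutator (vertex M X) (vertex M Y) a b)"
  unfolding anticommutator_def by (rule lin_plus[OF lin_compose[OF lin_vertex lin_vertex] lin_compose[OF lin_vertex lin_vertex]])

lemma anticommutator_weight_eq_0:
  assumes v: "weight x v"
    and e1: "hlog X * of_int (Q1 Y) + alog X * (Qa Y * beta p / 2) = of_int e1"
    and e2: "hlog Y * of_int (Q1 X) + alog Y * (Qa X * beta p / 2) = of_int e2"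
    and ab: "a - zexponent X x \<notin> \<int> \<or> b - zexponent Y x \<notin> \<int>"
  shows "anticommutator (vertex M X) (vertex M Y) a b v = 0"
  using vertex_vertex_eq_0[OF v e1 ab] vertex_vertex_eq_0[OF v e2, of b a] ab
  by (auto simp: anticommutator_def)

text \<open>The factor of \<open>X(z) Y(w)\<close> is \<open>r\<^sup>-\<^sup>1 z (1 - r w/z)\<close>, that of \<open>Y(w) X(z)\<close> is \<open>w (1 - r\<^sup>-\<^sup>1 z/w)\<close>, and the
  sum of these polynomials is zero.\<close>
lemma anticommutator_eq_0:
  assumes XY: "\<And>n. n > 0 \<Longrightarrow> contraction p X Y n = - (r ^ n / of_nat n)"
    and YX: "\<And>n. n > 0 \<Longrightarrow> contraction p Y X n = - (inverse r ^ n / of_nat n)"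
    and e1: "hlog X * of_int (Q1 Y) + alog X * (Qa Y * beta p / 2) = 1"
    and e2: "hlog Y * of_int (Q1 X) + alog Y * (Qa X * beta p / 2) = 1"
    and s1: "exp (hcst X * of_int (Q1 Y) + acst X * (Qa Y * beta p / 2)) = inverse r"
    and s2: "exp (hcst Y * of_int (Q1 X) + acst Y * (Qa X * beta p / 2)) = 1"
  shows "anticommutator (vertex M X) (vertex M Y) = (\<lambda>a b v. 0)"
proof (intro ext[of "anticommutator _ _"] ext[of "anticommutator _ _ _"] lin_eqI lin_anticommutator)
  show "lin (\<lambda>v. 0)" by (rule linI) simp_all
next
  fix a b x v assume v: "weight x v"
  have r: "r \<noteq> 0" using s1 by auto
  show "anticommutator (vertex M X) (vertex M Y) a b v = 0"
  proof (cases "a - zexponent X x \<notin> \<int> \<or> b - zexponent Y x \<notin> \<int>")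
    case True
    then show ?thesis using e1 e2
      by (intro anticommutator_weight_eq_0[OF v, where ?e1.0=1 and ?e2.0=1]) simp_all
  next
    case False
    then obtain m n where "a - zexponent X x = of_int m" "b - zexponent Y x = of_int n"
      by (auto elim!: Ints_cases)
    then have ab: "a = zexponent X x + of_int m" "b = zexponent Y x + of_int n"
      by (simp_all add: algebra_simps)
    define u where "u = expQ M (Q1 X + Q1 Y) (Qa X + Qa Y) v"
    have u': "u = expQ M (Q1 Y + Q1 X) (Qa Y + Qa X) v"
      by (simp add: u_def add.commute)
    obtain N where N: "\<And>i j. N < i + j \<Longrightarrow> ann X i (ann Y j u) = 0"
      using killed_pair_exists by blast
    have N': "ann Y i (ann X j u) = 0" if "N < i + j" for i j
      using N[of j i] that by (simp add: ann_commute add.commute)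
    define K where "K = nat (max m n + int N) + 1"
    have K: "n + int N \<le> int K" "m + int N \<le> int K" "1 \<le> K"
      by (auto simp: K_def)
    have sum01: "(\<Sum>k\<le>K. scl M (binomial_coeffs c k) (g k)) = g 0 - scl M c (g 1)" for c g
    proof -
      have "(\<Sum>k\<le>K. scl M (binomial_coeffs c k) (g k)) = (\<Sum>k\<in>{0, 1}. scl M (binomial_coeffs c k) (g k))"
        by (rule sum.mono_neutral_right) (use K in \<open>auto simp: binomial_coeffs_def\<close>)
      then show ?thesis by (simp add: binomial_coeffs_def)
    qed
    have b0: "binomial_coeffs c 0 = 1" for c by (simp add: binomial_coeffs_def)
    have "vertex M X a (vertex M Y b v) = scl M (zscalar X x * zscalar Y x * inverse r)
        (normally_ordered X Y N (m - 1) n u - scl M r (normally_ordered X Y N m (n - 1) u))"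
      unfolding ab
      using vertex_vertex[where e=1 and m=m, OF v u_def N b0 binomial_recursion[where r=r and c="contraction p X Y", OF XY] _ K(1)] e1 s1
      by (simp add: sum01)
    moreover have "vertex M Y b (vertex M X a v) = scl M (zscalar X x * zscalar Y x)
        (normally_ordered X Y N m (n - 1) u - scl M (inverse r) (normally_ordered X Y N (m - 1) n u))"
      unfolding ab
      using vertex_vertex[where e=1 and m=n, OF v u' N' b0 binomial_recursion[where r="inverse r" and c="contraction p Y X", OF YX] _ K(2)] e2 s2
      by (simp add: sum01 normally_ordered_commute[of Y X] mult.commute)
    ultimately show ?thesis
      using r by (simp add: anticommutator_def scale_right_diff_distrib)
  qed
qed

lemma delta_times_eq:
  "delta_times M l N a b v = (if a \<in> \<int> then scl M (exp (a * l)) (N (b + a) v) else 0)"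
proof (cases "a \<in> \<int>")
  case True
  then obtain n where n: "a = of_int n" by (auto elim: Ints_cases)
  have "delta_times M l N a b v =
      Sum_any (\<lambda>k. if k = - n then scl M (exp (a * l)) (N (b + a) v) else 0)"
    unfolding delta_times_def
  proof (rule Sum_any.cong)
    fix k :: int
    have "(a = - of_int k) = (k = - n)"
      unfolding n of_int_minus[symmetric] of_int_eq_iff by auto
    then show "(if a = - of_int k then scl M (exp (- of_int k * l)) (N (b - of_int k) v) else 0) =
        (if k = - n then scl M (exp (a * l)) (N (b + a) v) else 0)"
      by (auto simp: n)
  qed
  then show ?thesis using True by simp
next
  case False
  then have "(a = - of_int k) = False" for k by auto
  then show ?thesis using False by (simp add: delta_times_def)
qed

text \<open>With \<open>r = e\<^sup>l\<close> the factor of \<open>X(z) Y(w)\<close> is \<open>r z\<^sup>-\<^sup>1 / (1 - r w/z)\<close>, that of \<open>Y(w) X(z)\<close> is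
  \<open>w\<^sup>-\<^sup>1 / (1 - r\<^sup>-\<^sup>1 z/w)\<close>. Expanded in \<open>w/z\<close> and in \<open>z/w\<close> respectively, they add up to
  \<open>w\<^sup>-\<^sup>1 \<Sum>\<^sub>n (r w/z)\<^sup>n\<close> over all integers \<open>n\<close>. The powers of \<open>z\<close> in \<open>X(z)\<close> have to be integral, as
  only then does multiplication by the delta function set \<open>z = r w\<close>.\<close>
lemma anticommutator_eq_delta:
  assumes XY: "\<And>n. n > 0 \<Longrightarrow> contraction p X Y n = exp l ^ n / of_nat n"
    and YX: "\<And>n. n > 0 \<Longrightarrow> contraction p Y X n = exp (- l) ^ n / of_nat n"
    and e1: "hlog X * of_int (Q1 Y) + alog X * (Qa Y * beta p / 2) = - 1"
    and e2: "hlog Y * of_int (Q1 X) + alog Y * (Qa X * beta p / 2) = - 1"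
    and s1: "exp (hcst X * of_int (Q1 Y) + acst X * (Qa Y * beta p / 2)) = exp l"
    and s2: "exp (hcst Y * of_int (Q1 X) + acst Y * (Qa X * beta p / 2)) = 1"
    and integral: "hlog X \<in> \<int>" "alog X = 0"
  shows "anticommutator (vertex M X) (vertex M Y) =
    w_inverse_times (delta_times M (- l) (vertex M (nprod (rescale l X) Y)))"
proof (intro ext[of "anticommutator _ _"] ext[of "anticommutator _ _ _"] lin_eqI lin_anticommutator)
  let ?Z = "nprod (rescale l X) Y"
  show "lin (w_inverse_times (delta_times M (- l) (vertex M ?Z)) a b)" for a b
    unfolding w_inverse_times_def delta_times_eq
    by (rule linI) (simp_all add: lin_facts[OF lin_vertex] scale_right_distrib mult.commute)
  fix a b x v assume v: "weight x v"
  have zX: "zexponent X x \<in> \<int>" using integral by (simp add: zexponent_def)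
  have zZ: "zexponent ?Z x = zexponent X x + zexponent Y x"
    by (simp add: zexponent_def nprod_def rescale_def algebra_simps)
  have scZ: "zscalar ?Z x = zscalar X x * zscalar Y x * exp (l * zexponent X x)"
    by (simp add: zexponent_def zscalar_def nprod_def rescale_def algebra_simps flip: exp_add)
  have aZ: "a - zexponent X x \<in> \<int> \<longleftrightarrow> a \<in> \<int>"
    using zX by (metis Ints_add Ints_diff diff_add_cancel)
  show "anticommutator (vertex M X) (vertex M Y) a b v =
      w_inverse_times (delta_times M (- l) (vertex M ?Z)) a b v"
  proof (cases "a - zexponent X x \<notin> \<int> \<or> b - zexponent Y x \<notin> \<int>")
    case True
    then have "anticommutator (vertex M X) (vertex M Y) a b v = 0" using e1 e2
      by (intro anticommutator_weight_eq_0[OF v, where ?e1.0="-1" and ?e2.0="-1"]) simp_all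
    moreover have "a \<in> \<int> \<Longrightarrow> vertex M ?Z (b + 1 + a) v = 0"
    proof (rule vertex_weight_eq_0[OF v])
      assume "a \<in> \<int>"
      then have "a - zexponent X x + 1 \<in> \<int>" "b - zexponent Y x \<notin> \<int>" using True aZ by auto
      moreover have "b + 1 + a - zexponent ?Z x = (b - zexponent Y x) + (a - zexponent X x + 1)"
        by (simp add: zZ)
      ultimately show "b + 1 + a - zexponent ?Z x \<notin> \<int>"
        by (metis Ints_diff add_diff_cancel_right')
    qed
    ultimately show ?thesis
      by (simp add: w_inverse_times_def delta_times_eq)
  next
    case False
    then obtain m n where mn: "a - zexponent X x = of_int m" "b - zexponent Y x = of_int n"
      by (auto elim!: Ints_cases)
    then have ab: "a = zexponent X x + of_int m" "b = zexponent Y x + of_int n"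
      by (simp_all add: algebra_simps)
    define u where "u = expQ M (Q1 X + Q1 Y) (Qa X + Qa Y) v"
    have u': "u = expQ M (Q1 Y + Q1 X) (Qa Y + Qa X) v"
      by (simp add: u_def add.commute)
    obtain N where N: "\<And>i j. N < i + j \<Longrightarrow> ann X i (ann Y j u) = 0"
      and NZ: "\<And>i j. N < i + j \<Longrightarrow> ann ?Z (i + j) u = 0"
      using killed_pair_exists[of X Y u l] by blast
    have N': "ann Y i (ann X j u) = 0" if "N < i + j" for i j
      using N[of j i] that by (simp add: ann_commute add.commute)
    define K where "K = nat (max m n + int N) + 1"
    have K: "n + int N \<le> int K" "m + int N \<le> int K" "n + 1 + int N \<le> int K + 1" by (auto simp: K_def)
    \<comment> \<open>\<open>g k\<close> is the term of the delta function with index \<open>k\<close>; one product supplies \<open>k > 0\<close> and the other \<open>k \<le> 0\<close>.\<close>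
    define g where "g k = scl M (exp l powi k) (normally_ordered X Y N (m + k) (n + 1 - k) u)" for k :: int
    let ?c = "zscalar X x * zscalar Y x"
    have "vertex M X a (vertex M Y b v) = scl M (?c * exp l)
        (\<Sum>k\<le>K. scl M (exp l ^ k) (normally_ordered X Y N (m + 1 + int k) (n - int k) u))"
      unfolding ab
      using vertex_vertex[where e="-1" and m=m, OF v u_def N _ geometric_recursion[where r="exp l" and c="contraction p X Y", OF XY] _ K(1)] e1 s1
      by simp
    also have "\<dots> = scl M ?c (\<Sum>k\<le>K. g (int k + 1))"
      by (simp add: g_def scale_sum_right power_int_add algebra_simps)
    also have "(\<Sum>k\<le>K. g (int k + 1)) = (\<Sum>k\<in>{1..int K + 1}. g k)"
      by (rule sum.reindex_bij_witness[of _ "\<lambda>k. nat (k - 1)" "\<lambda>k. int k + 1"]) auto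
    finally have 1: "vertex M X a (vertex M Y b v) = scl M ?c (\<Sum>k\<in>{1..int K + 1}. g k)" .
    have "vertex M Y b (vertex M X a v) = scl M ?c
        (\<Sum>k\<le>K. scl M (exp (- l) ^ k) (normally_ordered X Y N (m - int k) (n + 1 + int k) u))"
      unfolding ab
      using vertex_vertex[where e="-1" and m=n, OF v u' N' _ geometric_recursion[where r="exp (- l)" and c="contraction p Y X", OF YX] _ K(2)] e2 s2
      by (simp add: normally_ordered_commute[of Y X] mult.commute)
    also have "\<dots> = scl M ?c (\<Sum>k\<le>K. g (- int k))"
      by (simp add: g_def scale_sum_right power_int_minus exp_minus power_inverse)
    also have "(\<Sum>k\<le>K. g (- int k)) = (\<Sum>k\<in>{- int K..0}. g k)"
      by (rule sum.reindex_bij_witness[of _ "\<lambda>k. nat (- k)" "\<lambda>k. - int k"]) auto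
    finally have 2: "vertex M Y b (vertex M X a v) = scl M ?c (\<Sum>k\<in>{- int K..0}. g k)" .
    have "{- int K..int K + 1} = {1..int K + 1} \<union> {- int K..0}" by auto
    then have "anticommutator (vertex M X) (vertex M Y) a b v = scl M ?c (\<Sum>k\<in>{- int K..int K + 1}. g k)"
      unfolding anticommutator_def 1 2 by (simp add: sum.union_disjoint scale_right_distrib)
    also have "(\<Sum>k\<in>{- int K..int K + 1}. g k) = scl M (exp l powi (- m))
       (\<Sum>i\<le>N. cre ?Z (m + (n + 1) + int i) (ann ?Z i u))"
      unfolding g_def by (rule normally_ordered_fuse[OF N]) (use K in auto)
    also have "scl M ?c \<dots> = scl M (exp (- (a * l))) (vertex M ?Z (b + 1 + a) v)"
    proof -
      have top: "b + 1 + a = zexponent ?Z x + of_int (m + (n + 1))"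
        by (simp add: ab zZ)
      have uZ: "expQ M (Q1 ?Z) (Qa ?Z) v = u"
        by (simp add: u_def nprod_def rescale_def)
      have "ann ?Z i (expQ M (Q1 ?Z) (Qa ?Z) v) = 0" if "N < i" for i
        using NZ[of 0 i] that by (simp add: uZ)
      from vertex_weight[OF v this] have "vertex M ?Z (b + 1 + a) v =
          scl M (zscalar ?Z x) (\<Sum>i\<le>N. cre ?Z (m + (n + 1) + int i) (ann ?Z i u))"
        unfolding top uZ .
      moreover have "?c * exp l powi (- m) = exp (- (a * l)) * zscalar ?Z x"
        unfolding scZ ab
        by (simp add: algebra_simps flip: exp_add) (simp add: exp_power_int mult.commute)
      ultimately show ?thesis by simp
    qed
    finally show ?thesis
      using False aZ by (simp add: w_inverse_times_def delta_times_eq)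
  qed
qed

end

section \<open>Contractions of the currents with the screening currents\<close>

text \<open>The logarithm of the other one of \<open>q\<^sub>1\<close> and \<open>q\<^sub>3\<close>. In terms of \<open>s\<close> and its dual the formulas for the
  two signs coincide.\<close>
fun dual_log_s :: "params \<Rightarrow> pm \<Rightarrow> complex" where
  "dual_log_s p Plus = hbar p"
| "dual_log_s p Minus = - beta p * hbar p"

lemma log_q_eq: "log_q p = - (log_s p \<sigma> + dual_log_s p \<sigma>) / 2"
  by (cases \<sigma>) (simp_all add: log_q_def field_simps)

lemma powers_independent:
  assumes "valid_params p" "qq p powi n * dd p powi m = 1"
  shows "n = 0" "m = 0"
  using assms unfolding valid_params_def by blast+

lemma beta_nonzero:
  assumes "valid_params p"
  shows "beta p \<noteq> 0"
proof
  assume "beta p = 0"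
  then have "qq p powi (- 1) * dd p powi (- 1) = 1"
    using assms by (auto simp: valid_params_def q3_def)
  from powers_independent(1)[OF assms this] show False by simp
qed

text \<open>What ties \<open>\<tau>\<close> to \<open>s\<close>: the first identity evaluates \<open>q\<^sub>1\<^sup>a\<close> (\<open>a\<close> being \<open>a\<^sub>0\<close>) against the charge \<open>\<tau> Q\<close>,
  and by the second the shift \<open>w \<mapsto> s w\<close> turns \<open>w\<^sup>2\<^sup>\<tau>\<^sup>a\<close> into \<open>w\<^sup>2\<^sup>\<tau>\<^sup>a q\<^sub>1\<^sup>-\<^sup>2\<^sup>a\<close>, where \<open>q\<^sub>1\<^sup>-\<^sup>2\<^sup>a\<close> is the
  quotient of the factors in \<open>\<Lambda>\<^sup>-\<close> and \<open>\<Lambda>\<^sup>+\<close>.\<close>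
lemma hbar_tau:
  assumes "valid_params p"
  shows "hbar p * (tau p \<sigma> * beta p / 2) = dual_log_s p \<sigma> / 2"
    and "log_s p \<sigma> * tau p \<sigma> = - hbar p"
  using beta_nonzero[OF assms] by (cases \<sigma>; simp)+

text \<open>All scalars attached to the modes of degree \<open>\<plusminus> k\<close> are rational functions of \<open>k\<close>, \<open>x = s\<^sup>k\<^sup>/\<^sup>2\<close> and its
  dual \<open>y\<close>. With \<open>x\<close> and \<open>y\<close> as variables the contractions become identities of rational functions.\<close>
locale mode_values =
  fixes p :: params and \<sigma> :: pm and k :: nat and x y :: complex
  assumes valid: "valid_params p" and k: "k > 0"
    and x: "x = exp (of_nat k * (log_s p \<sigma> / 2))" and y: "y = exp (of_nat k * (dual_log_s p \<sigma> / 2))"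
begin

lemma nonzero: "x \<noteq> 0" "y \<noteq> 0" "(of_nat k :: complex) \<noteq> 0"
  using k by (simp_all add: x y)

lemma q_power: "qq p ^ k = 1 / (x * y)" "qq p powi (- int k) = x * y"
proof -
  have "qq p = exp (log_q p)" using valid by (simp add: valid_params_def)
  then have "qq p ^ k = exp (of_nat k * log_q p)"
    by (simp add: exp_of_nat_mult)
  also have "of_nat k * log_q p = - (of_nat k * (log_s p \<sigma> / 2) + of_nat k * (dual_log_s p \<sigma> / 2))"
    by (simp add: log_q_eq[of p \<sigma>] field_simps)
  finally show "qq p ^ k = 1 / (x * y)"
    by (simp only: exp_minus exp_add x y inverse_eq_divide)
  then show "qq p powi (- int k) = x * y"
    by (simp add: power_int_minus)
qed

lemma q2_power: "q2 p ^ k = 1 / (x * y)\<^sup>2" "q2 p powi (- int k) = (x * y)\<^sup>2"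
proof -
  show q: "q2 p ^ k = 1 / (x * y)\<^sup>2"
    by (simp add: q2_def power_divide flip: power_mult) (simp add: mult.commute power_mult q_power power_divide)
  then show "q2 p powi (- int k) = (x * y)\<^sup>2"
    by (simp add: power_int_minus)
qed

lemma s_exp: "s p \<sigma> = exp (log_s p \<sigma>)"
  using valid by (cases \<sigma>) (simp_all add: valid_params_def)

lemma s_power: "s p \<sigma> ^ k = x\<^sup>2" "s p \<sigma> powi (2 * int k) = x ^ 4"
proof -
  show s: "s p \<sigma> ^ k = x\<^sup>2"
    by (simp add: s_exp x flip: exp_of_nat_mult exp_double)
  have "s p \<sigma> powi (2 * int k) = (s p \<sigma> ^ k)\<^sup>2"
    by (simp add: power_int_mult power_mult_distrib flip: power_mult) (simp add: mult.commute)
  then show "s p \<sigma> powi (2 * int k) = x ^ 4"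
    by (simp add: s)
qed

lemma q13_power: "q1 p ^ k + q3 p ^ k = x\<^sup>2 + y\<^sup>2"
proof -
  have "q1 p = exp (hbar p)" "q3 p = exp (- beta p * hbar p)" using valid by (simp_all add: valid_params_def)
  then show ?thesis
    by (cases \<sigma>) (simp_all add: x y add.commute flip: exp_double exp_of_nat_mult)
qed

lemma s_power_nontrivial: "x ^ 4 \<noteq> 1"
proof
  assume "x ^ 4 = 1"
  then have *: "s p \<sigma> powi (2 * int k) = 1" by (simp add: s_power)
  show False
  proof (cases \<sigma>)
    case Plus
    then have "qq p powi (- (2 * int k)) * dd p powi (- (2 * int k)) = 1"
      using * by (simp add: q3_def power_int_mult_distrib power_int_inverse power_int_minus)
    from powers_independent(1)[OF valid this] k show False by simp
  next
    case Minus
    then have "qq p powi (- (2 * int k)) * dd p powi (2 * int k) = 1"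
      using * by (simp add: q1_def power_int_mult_distrib power_int_inverse power_int_minus)
    from powers_independent(1)[OF valid this] k show False by simp
  qed
qed

lemma bracket_denominator: "1 + (x * y)\<^sup>2 \<noteq> 0"
proof
  assume "1 + (x * y)\<^sup>2 = 0"
  \<comment> \<open>A zero of the denominator would make \<open>q\<close> a root of unity.\<close>
  then have "((x * y)\<^sup>2)\<^sup>2 = (- 1)\<^sup>2" by (simp add: add_eq_0_iff)
  then have "(x * y) ^ 4 = 1" by simp
  then have "(qq p powi (- int k)) powi 4 = 1" by (simp add: q_power)
  then have "qq p powi (- (int k * 4)) * dd p powi 0 = 1"
    by (simp only: power_int_mult[symmetric]) simp
  from powers_independent(1)[OF valid this] show False using k by simp
qed

lemma gam_eq: "gam p \<sigma> (int k) = (1 + (x * y)\<^sup>2) / (of_nat k * y * (1 - x ^ 4))"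
proof -
  have "gam p \<sigma> (int k) = x * (1 + 1 / (x * y)\<^sup>2) / (of_nat k * (1 / (x * y)) * (1 - x ^ 4))"
    unfolding gam_def by (simp add: q_power q2_power s_power x)
  also have "\<dots> = (1 + (x * y)\<^sup>2) / (of_nat k * y * (1 - x ^ 4))"
    using nonzero s_power_nontrivial by (simp add: divide_simps power2_eq_square power4_eq_xxxx)
  finally show ?thesis .
qed

lemma bracket_eq:
  "bracket p i i (int k) = of_nat k"
  "i \<noteq> j \<Longrightarrow> bracket p i j (int k) = - of_nat k * (x\<^sup>2 + y\<^sup>2) / (1 + (x * y)\<^sup>2)"
  by (simp_all add: bracket_def q13_power q2_power)

text \<open>The pairing of \<open>h\<^sub>i\<^sub>,\<^sub>k\<close> with the creation modes of \<open>S\<^sub>i\<close>, up to the factor \<open>k\<close>. The numerator is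
  \<open>1 - x\<^sup>4\<close>, which cancels the pole of \<open>\<gamma>\<close>.\<close>
lemma pairing_same: "gam p \<sigma> (int k) * (1 - x\<^sup>2 * (x\<^sup>2 + y\<^sup>2) / (1 + (x * y)\<^sup>2)) = 1 / (of_nat k * y)"
  using nonzero s_power_nontrivial bracket_denominator unfolding gam_eq
  by (simp add: divide_simps power2_eq_square power4_eq_xxxx) (simp add: algebra_simps)

text \<open>The pairing of \<open>h\<^sub>i\<^sub>,\<^sub>k\<close> with the creation modes of the screening current of the other boson, up to the
  factor \<open>k\<close>; the numerator is \<open>y\<^sup>2 (x\<^sup>4 - 1)\<close>.\<close>
lemma pairing_diff: "gam p \<sigma> (int k) * (x\<^sup>2 - (x\<^sup>2 + y\<^sup>2) / (1 + (x * y)\<^sup>2)) = - y / of_nat k"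
  using nonzero s_power_nontrivial bracket_denominator unfolding gam_eq
  by (simp add: divide_simps power2_eq_square power4_eq_xxxx) (simp add: algebra_simps)

lemma contraction_12:
  assumes "i \<in> {1, 2}" "j \<in> {1, 2}" "i \<noteq> j"
  shows "contraction p X Y k = of_nat k * (
      osc X i (int k) * (osc Y i (- int k) - osc Y j (- int k) * ((x\<^sup>2 + y\<^sup>2) / (1 + (x * y)\<^sup>2)))
    + osc X j (int k) * (osc Y j (- int k) - osc Y i (- int k) * ((x\<^sup>2 + y\<^sup>2) / (1 + (x * y)\<^sup>2))))"
proof -
  have "{1, 2} = {i, j}" using assms by auto
  then show ?thesis
    using assms(3) unfolding contraction_def
    by (simp add: bracket_eq) (simp add: algebra_simps)
qed

lemma osc_Lambda:
  "osc (Lambda_plus p i) i (int k) = - (1 / (of_nat k * x * y))"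
  "osc (Lambda_plus p i) i (- int k) = x * y / of_nat k"
  "osc (Lambda_minus p i) i (int k) = x * y / of_nat k"
  "osc (Lambda_minus p i) i (- int k) = - (1 / (of_nat k * x * y))"
  "i \<noteq> j \<Longrightarrow> osc (Lambda_plus p i) j n = 0"
  "i \<noteq> j \<Longrightarrow> osc (Lambda_minus p i) j n = 0"
  by (simp_all add: Lambda_plus_def Lambda_minus_def q_power mult_ac)

lemma osc_Screen:
  "osc (Screen p \<sigma> i) i (int k) = gam p \<sigma> (int k) * x\<^sup>2"
  "osc (Screen p \<sigma> i) i (- int k) = gam p \<sigma> (int k)"
  "i \<noteq> j \<Longrightarrow> osc (Screen p \<sigma> i) j (int k) = gam p \<sigma> (int k)"
  "i \<noteq> j \<Longrightarrow> osc (Screen p \<sigma> i) j (- int k) = gam p \<sigma> (int k) * x\<^sup>2"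
  using k by (auto simp: Screen_def s_power)

text \<open>Every contraction is \<open>\<plusminus> r\<^sup>k / k\<close>, so every contraction factor is \<open>(1 - r t)\<^sup>\<mp>\<^sup>1\<close>; exchanging the two
  operators inverts \<open>r\<close>.\<close>
lemma contraction_Lambda_Screen:
  assumes ij: "i \<in> {1, 2}" "j \<in> {1, 2}" "i \<noteq> j"
  shows "contraction p (Lambda_plus p i) (Screen p \<sigma> i) k = - (1 / (x * y\<^sup>2) / of_nat k)"
    and "contraction p (Screen p \<sigma> i) (Lambda_plus p i) k = - (x * y\<^sup>2 / of_nat k)"
    and "contraction p (Lambda_plus p i) (Screen p \<sigma> j) k = 1 / x / of_nat k"
    and "contraction p (Screen p \<sigma> j) (Lambda_plus p i) k = x / of_nat k"
    and "contraction p (Lambda_minus p i) (Screen p \<sigma> i) k = x / of_nat k"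
    and "contraction p (Screen p \<sigma> i) (Lambda_minus p i) k = 1 / x / of_nat k"
    and "contraction p (Lambda_minus p i) (Screen p \<sigma> j) k = - (x * y\<^sup>2 / of_nat k)"
    and "contraction p (Screen p \<sigma> j) (Lambda_minus p i) k = - (1 / (x * y\<^sup>2) / of_nat k)"
proof -
  let ?g = "gam p \<sigma> (int k)" and ?b = "(x\<^sup>2 + y\<^sup>2) / (1 + (x * y)\<^sup>2)"
  have same: "?g - ?g * x\<^sup>2 * ?b = 1 / (of_nat k * y)"
    using pairing_same by (simp add: algebra_simps)
  have diff: "?g * x\<^sup>2 - ?g * ?b = - y / of_nat k"
    using pairing_diff by (simp add: algebra_simps)
  have collect: "u * w - v * (w * b) = (u - v * b) * w" for u v w b :: complex
    by (simp add: algebra_simps)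
  have c1: "contraction p X (Screen p \<sigma> i) k = osc X i (int k) / y" if "osc X j (int k) = 0" for X
    using nonzero that ij unfolding contraction_12[OF ij] osc_Screen(2) osc_Screen(4)[OF ij(3)] same by simp
  have c2: "contraction p X (Screen p \<sigma> j) k = - osc X i (int k) * y" if X: "osc X j (int k) = 0" for X
  proof -
    have "contraction p X (Screen p \<sigma> j) k = of_nat k * (osc X i (int k) * (?g * x\<^sup>2 - ?g * ?b))"
      unfolding contraction_12[OF ij] osc_Screen(2) osc_Screen(4)[OF ij(3)[symmetric]] X by simp
    then show ?thesis using nonzero by (simp only: diff) simp
  qed
  have c3: "contraction p (Screen p \<sigma> i) X k = - osc X i (- int k) * y" if X: "osc X j (- int k) = 0" for X
  proof -
    have "contraction p (Screen p \<sigma> i) X k = of_nat k * ((?g * x\<^sup>2 - ?g * ?b) * osc X i (- int k))"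
      unfolding contraction_12[OF ij] osc_Screen(1) osc_Screen(3)[OF ij(3)] X by (simp add: algebra_simps)
    then show ?thesis using nonzero by (simp only: diff) simp
  qed
  have c4: "contraction p (Screen p \<sigma> j) X k = osc X i (- int k) / y" if X: "osc X j (- int k) = 0" for X
  proof -
    have "contraction p (Screen p \<sigma> j) X k = of_nat k * ((?g - ?g * x\<^sup>2 * ?b) * osc X i (- int k))"
      unfolding contraction_12[OF ij] osc_Screen(1) osc_Screen(3)[OF ij(3)[symmetric]] X by (simp add: algebra_simps)
    then show ?thesis using nonzero by (simp only: same) simp
  qed
  note z = osc_Lambda(5,6)[OF ij(3)]
  show "contraction p (Lambda_plus p i) (Screen p \<sigma> i) k = - (1 / (x * y\<^sup>2) / of_nat k)"
    "contraction p (Lambda_minus p i) (Screen p \<sigma> i) k = x / of_nat k"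
    using nonzero by (simp_all add: c1 z osc_Lambda(1-4) field_simps power2_eq_square)
  show "contraction p (Lambda_plus p i) (Screen p \<sigma> j) k = 1 / x / of_nat k"
    "contraction p (Lambda_minus p i) (Screen p \<sigma> j) k = - (x * y\<^sup>2 / of_nat k)"
    using nonzero by (simp_all add: c2 z osc_Lambda(1-4) field_simps power2_eq_square)
  show "contraction p (Screen p \<sigma> i) (Lambda_plus p i) k = - (x * y\<^sup>2 / of_nat k)"
    "contraction p (Screen p \<sigma> i) (Lambda_minus p i) k = 1 / x / of_nat k"
    using nonzero by (simp_all add: c3 z osc_Lambda(1-4) field_simps power2_eq_square)
  show "contraction p (Screen p \<sigma> j) (Lambda_plus p i) k = x / of_nat k"
    "contraction p (Screen p \<sigma> j) (Lambda_minus p i) k = - (1 / (x * y\<^sup>2) / of_nat k)"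
    using nonzero by (simp_all add: c4 z osc_Lambda(1-4) field_simps power2_eq_square)
qed

text \<open>The oscillators of \<open>:\<Lambda>\<^sub>i\<^sup>-(s\<^sup>1\<^sup>/\<^sup>2 w) S\<^sub>i(w):\<close> and \<open>:\<Lambda>\<^sub>i\<^sup>+(s\<^sup>1\<^sup>/\<^sup>2 w) S\<^sub>j(s w):\<close> agree in the modes of \<open>h\<^sub>i\<close>; \<open>\<gamma>\<close> is
  designed so that replacing \<open>\<Lambda>\<^sup>-\<close> by \<open>\<Lambda>\<^sup>+\<close> is compensated by exchanging the screening currents and
  shifting the argument.\<close>
lemma osc_shift:
  assumes ij: "i \<noteq> j"
  shows "osc (Lambda_minus p i) i (int k) / x + osc (Screen p \<sigma> i) i (int k) =
      (osc (Lambda_plus p i) i (int k) * x + osc (Screen p \<sigma> j) i (int k)) / x\<^sup>2"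
    and "osc (Lambda_minus p i) i (- int k) * x + osc (Screen p \<sigma> i) i (- int k) =
      (osc (Lambda_plus p i) i (- int k) / x + osc (Screen p \<sigma> j) i (- int k)) * x\<^sup>2"
  using nonzero s_power_nontrivial ij unfolding osc_Lambda osc_Screen osc_Screen(3,4)[OF ij[symmetric]] gam_eq
  by (simp_all add: divide_simps power2_eq_square power4_eq_xxxx) (simp_all add: algebra_simps)

end

section \<open>The currents and the screening currents\<close>

lemma chi_12:
  assumes "i \<in> {1, 2}" "j \<in> {1, 2}" "i \<noteq> j"
  shows "chi i * chi i = 1" "chi j = - chi i"
  using assms by (auto simp: chi_def)

text \<open>The scalars that arise when the zero modes of the first operator pass the charge of the second. They are
  exactly the prefactors for which the contraction factors cancel, or combine to a delta function.\<close>
lemma zero_mode_factors: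
  assumes "valid_params p" and ij: "i \<in> {1, 2}" "j \<in> {1, 2}" "i \<noteq> j"
  defines "factor X Y \<equiv> exp (hcst X * of_int (Q1 Y) + acst X * (Qa Y * beta p / 2))"
  shows "factor (Lambda_plus p i) (Screen p \<sigma> i) = exp (log_s p \<sigma> / 2 + dual_log_s p \<sigma>)"
    and "factor (Lambda_plus p i) (Screen p \<sigma> j) = exp (- log_s p \<sigma> / 2)"
    and "factor (Lambda_minus p i) (Screen p \<sigma> i) = exp (log_s p \<sigma> / 2)"
    and "factor (Lambda_minus p i) (Screen p \<sigma> j) = exp (- (log_s p \<sigma> / 2 + dual_log_s p \<sigma>))"
    and "factor (Screen p \<sigma> i) X = 1"
proof -
  define c :: complex where "c = of_int (chi i)"
  have "c * c = 1"
    unfolding c_def of_int_mult[symmetric] chi_12(1)[OF ij] by simp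
  then have c: "c * z * c = z" for z
    by (metis mult.assoc mult.commute mult_1)
  have cj: "of_int (chi j) = - c"
    by (simp add: c_def chi_12(2)[OF ij])
  have "factor (Lambda_plus p i) (Screen p \<sigma> i) = exp (c * (- log_q p) * c + hbar p * (tau p \<sigma> * beta p / 2))"
    by (simp add: factor_def Lambda_plus_def Screen_def c_def)
  then show "factor (Lambda_plus p i) (Screen p \<sigma> i) = exp (log_s p \<sigma> / 2 + dual_log_s p \<sigma>)"
    unfolding c hbar_tau(1)[OF assms(1)] by (simp add: log_q_eq[of p \<sigma>] field_simps)
  have "factor (Lambda_plus p i) (Screen p \<sigma> j) = exp (c * log_q p * c + hbar p * (tau p \<sigma> * beta p / 2))"
    by (simp add: factor_def Lambda_plus_def Screen_def cj flip: c_def)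
  then show "factor (Lambda_plus p i) (Screen p \<sigma> j) = exp (- log_s p \<sigma> / 2)"
    unfolding c hbar_tau(1)[OF assms(1)] by (simp add: log_q_eq[of p \<sigma>] field_simps)
  have "factor (Lambda_minus p i) (Screen p \<sigma> i) = exp (c * (- log_q p) * c - hbar p * (tau p \<sigma> * beta p / 2))"
    by (simp add: factor_def Lambda_minus_def Screen_def flip: c_def)
  then show "factor (Lambda_minus p i) (Screen p \<sigma> i) = exp (log_s p \<sigma> / 2)"
    unfolding c hbar_tau(1)[OF assms(1)] by (simp add: log_q_eq[of p \<sigma>] field_simps)
  have exponent: "log_q p - dual_log_s p \<sigma> / 2 = - (log_s p \<sigma> / 2 + dual_log_s p \<sigma>)"
    by (simp add: log_q_eq[of p \<sigma>] field_simps)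
  have "factor (Lambda_minus p i) (Screen p \<sigma> j) = exp (c * log_q p * c - hbar p * (tau p \<sigma> * beta p / 2))"
    by (simp add: factor_def Lambda_minus_def Screen_def cj flip: c_def)
  then show "factor (Lambda_minus p i) (Screen p \<sigma> j) = exp (- (log_s p \<sigma> / 2 + dual_log_s p \<sigma>))"
    unfolding c hbar_tau(1)[OF assms(1)] by (simp only: exponent)
  show "factor (Screen p \<sigma> i) X = 1"
    by (simp add: factor_def Screen_def)
qed

context heisenberg_module
begin

context
  fixes i j :: nat and \<sigma> :: pm
  assumes valid: "valid_params p" and ij: "i \<in> {1, 2}" "j \<in> {1, 2}" "i \<noteq> j"
begin

lemma mode_valuesI:
  "k > 0 \<Longrightarrow> mode_values p \<sigma> k (exp (of_nat k * (log_s p \<sigma> / 2))) (exp (of_nat k * (dual_log_s p \<sigma> / 2)))"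
  by unfold_locales (use valid in auto)

lemmas contr = mode_values.contraction_Lambda_Screen[OF mode_valuesI ij]

lemma exp_powers:
  "exp (- log_s p \<sigma> / 2) ^ n = 1 / exp (of_nat n * (log_s p \<sigma> / 2))"
  "exp (log_s p \<sigma> / 2) ^ n = exp (of_nat n * (log_s p \<sigma> / 2))"
  "exp (log_s p \<sigma> / 2 + dual_log_s p \<sigma>) ^ n =
     exp (of_nat n * (log_s p \<sigma> / 2)) * (exp (of_nat n * (dual_log_s p \<sigma> / 2)))\<^sup>2"
  "exp (- (log_s p \<sigma> / 2 + dual_log_s p \<sigma>)) ^ n =
     1 / (exp (of_nat n * (log_s p \<sigma> / 2)) * (exp (of_nat n * (dual_log_s p \<sigma> / 2)))\<^sup>2)"
  unfolding exp_of_nat_mult[symmetric] exp_double[symmetric] inverse_eq_divide[symmetric] exp_minus[symmetric]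
    exp_add[symmetric]
  by (simp_all add: algebra_simps)

lemma log_exponents:
  "hlog (Lambda_plus p i) * of_int (Q1 (Screen p \<sigma> i)) + alog (Lambda_plus p i) * z = 1"
  "hlog (Lambda_plus p i) * of_int (Q1 (Screen p \<sigma> j)) + alog (Lambda_plus p i) * z = - 1"
  "hlog (Lambda_minus p i) * of_int (Q1 (Screen p \<sigma> i)) + alog (Lambda_minus p i) * z = - 1"
  "hlog (Lambda_minus p i) * of_int (Q1 (Screen p \<sigma> j)) + alog (Lambda_minus p i) * z = 1"
  "hlog (Screen p \<sigma> i) * of_int (Q1 (Lambda_plus p i)) + alog (Screen p \<sigma> i) * (Qa (Lambda_plus p i) * z / 2) = 1"
  "hlog (Screen p \<sigma> j) * of_int (Q1 (Lambda_plus p i)) + alog (Screen p \<sigma> j) * (Qa (Lambda_plus p i) * z / 2) = - 1"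
  "hlog (Screen p \<sigma> i) * of_int (Q1 (Lambda_minus p i)) + alog (Screen p \<sigma> i) * (Qa (Lambda_minus p i) * z / 2) = - 1"
  "hlog (Screen p \<sigma> j) * of_int (Q1 (Lambda_minus p i)) + alog (Screen p \<sigma> j) * (Qa (Lambda_minus p i) * z / 2) = 1"
  using arg_cong[OF chi_12(1)[OF ij], of "of_int :: int \<Rightarrow> complex"]
  by (simp_all add: Lambda_plus_def Lambda_minus_def Screen_def chi_12(2)[OF ij])

lemma anticommutator_Lambda_plus_same:
  "anticommutator (vertex M (Lambda_plus p i)) (vertex M (Screen p \<sigma> i)) = (\<lambda>a b v. 0)"
  by (rule anticommutator_eq_0[where r="exp (- (log_s p \<sigma> / 2 + dual_log_s p \<sigma>))"])
    (simp_all only: exp_powers contr log_exponents zero_mode_factors[OF valid ij] exp_minus[symmetric] minus_minus)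

lemma anticommutator_Lambda_minus_diff:
  "anticommutator (vertex M (Lambda_minus p i)) (vertex M (Screen p \<sigma> j)) = (\<lambda>a b v. 0)"
  by (rule anticommutator_eq_0[where r="exp (log_s p \<sigma> / 2 + dual_log_s p \<sigma>)"])
    (simp_all only: exp_powers contr log_exponents zero_mode_factors[OF valid ij]
      zero_mode_factors(5)[OF valid ij(2,1) ij(3)[symmetric]] exp_minus[symmetric])

lemma hlog_integral: "hlog (Lambda_plus p i) \<in> \<int>" "alog (Lambda_plus p i) = 0"
  "hlog (Lambda_minus p i) \<in> \<int>" "alog (Lambda_minus p i) = 0"
  by (simp_all add: Lambda_plus_def Lambda_minus_def)

lemma anticommutator_Lambda_plus_diff:
  "anticommutator (vertex M (Lambda_plus p i)) (vertex M (Screen p \<sigma> j)) =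
    w_inverse_times (delta_times M (log_s p \<sigma> / 2)
      (vertex M (nprod (rescale (- log_s p \<sigma> / 2) (Lambda_plus p i)) (Screen p \<sigma> j))))"
proof -
  have "log_s p \<sigma> / 2 = - (- log_s p \<sigma> / 2)" by simp
  then show ?thesis
    by (simp only:) (rule anticommutator_eq_delta[OF _ _ _ _ _ _ hlog_integral(1,2)],
      simp_all only: exp_powers contr log_exponents zero_mode_factors[OF valid ij]
      zero_mode_factors(5)[OF valid ij(2,1) ij(3)[symmetric]] minus_divide_left minus_minus)
qed

lemma anticommutator_Lambda_minus_same:
  "anticommutator (vertex M (Lambda_minus p i)) (vertex M (Screen p \<sigma> i)) =
    w_inverse_times (delta_times M (- (log_s p \<sigma> / 2))
      (vertex M (nprod (rescale (log_s p \<sigma> / 2) (Lambda_minus p i)) (Screen p \<sigma> i))))"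
  by (rule anticommutator_eq_delta[OF _ _ _ _ _ _ hlog_integral(3,4)])
    (simp_all only: exp_powers contr log_exponents zero_mode_factors[OF valid ij]
      minus_divide_left)

text \<open>\<open>:\<Lambda>\<^sub>i\<^sup>-(s\<^sup>1\<^sup>/\<^sup>2 w) S\<^sub>i(w): = :\<Lambda>\<^sub>i\<^sup>+(s\<^sup>1\<^sup>/\<^sup>2 w) S\<^sub>j(s w):\<close>, which makes one delta term the shift of the
  other.\<close>
lemma vertex_fused:
  "vertex M (nprod (rescale (log_s p \<sigma> / 2) (Lambda_minus p i)) (Screen p \<sigma> i)) =
   vertex M (rescale (log_s p \<sigma>) (nprod (rescale (- log_s p \<sigma> / 2) (Lambda_plus p i)) (Screen p \<sigma> j)))"
proof (rule vertex_cong)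
  let ?L = "nprod (rescale (log_s p \<sigma> / 2) (Lambda_minus p i)) (Screen p \<sigma> i)"
  let ?R = "rescale (log_s p \<sigma>) (nprod (rescale (- log_s p \<sigma> / 2) (Lambda_plus p i)) (Screen p \<sigma> j))"
  fix l n assume "l \<in> {1, 2::nat}"
  then have l: "l = i \<or> l = j" using ij by auto
  consider "n = 0" | k where "k > 0" "n = int k" | k where "k > 0" "n = - int k"
    by (metis int_cases2 of_nat_0 of_nat_eq_0_iff neg_0_equal_iff_equal gr0I)
  then show "osc ?L l n = osc ?R l n"
  proof cases
    case 1
    then show ?thesis
      by (simp add: nprod_def rescale_def Lambda_plus_def Lambda_minus_def Screen_def gam_def)
  next
    case 2
    define x where "x = exp (of_nat k * (log_s p \<sigma> / 2))"
    define y where "y = exp (of_nat k * (dual_log_s p \<sigma> / 2))"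
    interpret mode_values p \<sigma> k x y
      unfolding x_def y_def by (rule mode_valuesI) (rule 2(1))
    have e: "exp (- (of_nat k * log_s p \<sigma> / 2)) = 1 / x" "exp (of_nat k * log_s p \<sigma> / 2) = x"
      "exp (- (of_nat k * log_s p \<sigma>)) = 1 / x\<^sup>2"
      by (simp_all add: x_def exp_minus inverse_eq_divide flip: exp_double)
    from l show ?thesis
      using osc_shift(1)[OF ij(3)] osc_Screen(3)[OF ij(3)] osc_Screen(1)[of j] osc_Lambda(5,6)[OF ij(3)] nonzero
      by (auto simp: nprod_def rescale_def e 2(2))
  next
    case 3
    define x where "x = exp (of_nat k * (log_s p \<sigma> / 2))"
    define y where "y = exp (of_nat k * (dual_log_s p \<sigma> / 2))"
    interpret mode_values p \<sigma> k x y
      unfolding x_def y_def by (rule mode_valuesI) (rule 3(1))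
    have e: "exp (- (of_nat k * log_s p \<sigma> / 2)) = 1 / x" "exp (of_nat k * log_s p \<sigma> / 2) = x"
      "exp (of_nat k * log_s p \<sigma>) = x\<^sup>2"
      by (simp_all add: x_def exp_minus inverse_eq_divide flip: exp_double)
    from l show ?thesis
      using osc_shift(2)[OF ij(3)] osc_Screen(4)[OF ij(3)] osc_Screen(2)[of j] osc_Lambda(5,6)[OF ij(3)] nonzero
      by (auto simp: nprod_def rescale_def e 3(2))
  qed
next
  have "hbar p * 2 + log_s p \<sigma> * (tau p \<sigma> * 2) = 2 * (hbar p + log_s p \<sigma> * tau p \<sigma>)"
    by (simp add: algebra_simps)
  then have "hbar p * 2 + log_s p \<sigma> * (tau p \<sigma> * 2) = 0"
    by (simp add: hbar_tau(2)[OF valid])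
  then show "acst (nprod (rescale (log_s p \<sigma> / 2) (Lambda_minus p i)) (Screen p \<sigma> i)) =
      acst (rescale (log_s p \<sigma>) (nprod (rescale (- log_s p \<sigma> / 2) (Lambda_plus p i)) (Screen p \<sigma> j)))"
    by (simp add: nprod_def rescale_def Lambda_plus_def Lambda_minus_def Screen_def mult_ac add_eq_0_iff)
qed (simp_all add: nprod_def rescale_def Lambda_plus_def Lambda_minus_def Screen_def chi_12(2)[OF ij] algebra_simps)

text \<open>The first relation for an arbitrary boson \<open>i\<close>, with \<open>S\<^sub>i - S\<^sub>j\<close> in place of \<open>S\<^sub>1 - S\<^sub>2\<close>. The second
  relation is the case \<open>i = 2\<close> up to a sign.\<close>
lemma anticommutator_currents:
  fixes D
  defines "D \<equiv> delta_times M (log_s p \<sigma> / 2)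
      (vertex M (nprod (rescale (- log_s p \<sigma> / 2) (Lambda_plus p i)) (Screen p \<sigma> j)))"
  shows "anticommutator (W p M i) (\<lambda>b v. vertex M (Screen p \<sigma> i) b v - vertex M (Screen p \<sigma> j) b v) =
    w_inverse_times (shift_w M (log_s p \<sigma>) D - D)"
proof (intro ext)
  fix a b v
  have "anticommutator (W p M i) (\<lambda>b v. vertex M (Screen p \<sigma> i) b v - vertex M (Screen p \<sigma> j) b v) a b v =
     (anticommutator (vertex M (Lambda_plus p i)) (vertex M (Screen p \<sigma> i)) a b v
     + anticommutator (vertex M (Lambda_minus p i)) (vertex M (Screen p \<sigma> i)) a b v)
     - (anticommutator (vertex M (Lambda_plus p i)) (vertex M (Screen p \<sigma> j)) a b v
     + anticommutator (vertex M (Lambda_minus p i)) (vertex M (Screen p \<sigma> j)) a b v)"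
    by (simp add: anticommutator_def W_def lin_facts[OF lin_vertex])
  also have "\<dots> = w_inverse_times (delta_times M (- (log_s p \<sigma> / 2))
      (vertex M (nprod (rescale (log_s p \<sigma> / 2) (Lambda_minus p i)) (Screen p \<sigma> i)))) a b v - w_inverse_times D a b v"
    by (simp add: anticommutator_Lambda_plus_same anticommutator_Lambda_minus_diff
      anticommutator_Lambda_plus_diff anticommutator_Lambda_minus_same D_def)
  also have "\<dots> = w_inverse_times (shift_w M (log_s p \<sigma>) D - D) a b v"
    by (simp add: w_inverse_times_def shift_w_def delta_times_eq D_def vertex_fused vertex_rescale
      algebra_simps flip: exp_add)
  finally show "anticommutator (W p M i) (\<lambda>b v. vertex M (Screen p \<sigma> i) b v - vertex M (Screen p \<sigma> j) b v) a b v =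
     w_inverse_times (shift_w M (log_s p \<sigma>) D - D) a b v" .
qed

end

end

theorem proposition4p2:
  fixes p :: params and M :: "'v::ab_group_add heis_module" and \<sigma> :: pm
  assumes "valid_params p" and "heisenberg_module M p"
  shows
    "(let D = delta_times M (log_s p \<sigma> / 2)
          (vertex M (nprod (rescale (- log_s p \<sigma> / 2) (Lambda_plus p 1)) (Screen p \<sigma> 2)))
      in anticommutator (W p M 1) (S p M \<sigma>) =
           w_inverse_times (shift_w M (log_s p \<sigma>) D - D)) \<and>
     (let D = delta_times M (log_s p \<sigma> / 2)
          (vertex M (nprod (rescale (- log_s p \<sigma> / 2) (Lambda_plus p 2)) (Screen p \<sigma> 1)))
      in anticommutator (W p M 2) (S p M \<sigma>) =
           w_inverse_times (D - shift_w M (log_s p \<sigma>) D))"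
proof -
  interpret heisenberg_module M p by fact
  have 1: "anticommutator (W p M 1) (S p M \<sigma>) = w_inverse_times (shift_w M (log_s p \<sigma>) D - D)"
    if "D = delta_times M (log_s p \<sigma> / 2)
          (vertex M (nprod (rescale (- log_s p \<sigma> / 2) (Lambda_plus p 1)) (Screen p \<sigma> 2)))" for D
    unfolding that S_def by (rule anticommutator_currents[OF assms(1)]) simp_all
  have 2: "anticommutator (W p M 2) (S p M \<sigma>) = w_inverse_times (D - shift_w M (log_s p \<sigma>) D)"
    if D: "D = delta_times M (log_s p \<sigma> / 2)
          (vertex M (nprod (rescale (- log_s p \<sigma> / 2) (Lambda_plus p 2)) (Screen p \<sigma> 1)))" for D
  proof (intro ext)
    fix a b v
    let ?S' = "\<lambda>b v. vertex M (Screen p \<sigma> 2) b v - vertex M (Screen p \<sigma> 1) b v"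
    have "anticommutator (W p M 2) (S p M \<sigma>) a b v = - anticommutator (W p M 2) ?S' a b v"
      by (simp add: anticommutator_def W_def S_def lin_facts[OF lin_vertex])
    also have "anticommutator (W p M 2) ?S' = w_inverse_times (shift_w M (log_s p \<sigma>) D - D)"
      unfolding D by (rule anticommutator_currents[OF assms(1)]) simp_all
    finally show "anticommutator (W p M 2) (S p M \<sigma>) a b v =
        w_inverse_times (D - shift_w M (log_s p \<sigma>) D) a b v"
      by (simp add: w_inverse_times_def)
  qed
  show ?thesis unfolding Let_def using 1 2 by blast
qed

end
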